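(* For every function $p=p(n)\in[0,1]$, asymptotically almost surely (i.e. with probability tending to $1$ as $n\to\infty$) \[ T(\mathcal G(n,p))=\min\Big\{\delta(\mathcal G(n,p)),\ \Big\lfloor \frac{m(\mathcal G(n,p))}{n-1}\Big\rfloor\Big\}. \]
   Context: $\mathcal G(n,p)$ is the Erdős–Rényi random graph on vertex set $[n]=\{1,\dots,n\}$ in which each of the $\binom n2$ possible edges is present independently with probability $p$. For a graph $G$, $m(G)$ denotes its number of edges, $\delta(G)$ its minimum degree, and $T(G)$ its spanning-tree packing number, i.e. the maximum number of pairwise edge-disjoint spanning trees of $G$ (this is $0$ if $G$ is disconnected). *)

theory Defs
  imports Complex_Main
begin

text \<open>Graphs on the vertex set [n] = {1..n} are represented by their edge sets;
an edge is a 2-element set of vertices.\<close>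

definition all_edges :: "nat \<Rightarrow> nat set set" where
  "all_edges n = {e. \<exists>i j. i \<in> {1..n} \<and> j \<in> {1..n} \<and> i \<noteq> j \<and> e = {i, j}}"

text \<open>Probability that G(n,p) (edges present independently with prob. p) has property Q.\<close>
definition prob_Gnp :: "nat \<Rightarrow> real \<Rightarrow> (nat set set \<Rightarrow> bool) \<Rightarrow> real" where
  "prob_Gnp n p Q = (\<Sum>E \<in> {E. E \<subseteq> all_edges n \<and> Q E}.
      p ^ card E * (1 - p) ^ (card (all_edges n) - card E))"

definition adj_rel :: "nat set set \<Rightarrow> (nat \<times> nat) set" where
  "adj_rel F = {(x, y). {x, y} \<in> F \<and> x \<noteq> y}"

definition connected_on :: "nat set \<Rightarrow> nat set set \<Rightarrow> bool" where
  "connected_on V F \<longleftrightarrow> (\<forall>u\<in>V. \<forall>v\<in>V. (u, v) \<in> (adj_rel F)\<^sup>*)"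

text \<open>A cycle: at least 3 distinct vertices v_0,...,v_{k-1}, consecutive ones
(cyclically) joined by edges.\<close>
definition has_cycle :: "nat set set \<Rightarrow> bool" where
  "has_cycle F \<longleftrightarrow> (\<exists>vs. length vs \<ge> 3 \<and> distinct vs \<and>
      (\<forall>i < length vs. {vs ! i, vs ! ((i + 1) mod length vs)} \<in> F))"

text \<open>Spanning tree of the graph ([n], E): a connected acyclic subgraph containing all vertices.\<close>
definition spanning_tree :: "nat \<Rightarrow> nat set set \<Rightarrow> nat set set \<Rightarrow> bool" where
  "spanning_tree n E T \<longleftrightarrow> T \<subseteq> E \<and> connected_on {1..n} T \<and> \<not> has_cycle T"

text \<open>Spanning tree packing number: maximum number of pairwise edge-disjoint spanning trees.\<close>
definition tree_packing :: "nat \<Rightarrow> nat set set \<Rightarrow> nat" where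
  "tree_packing n E = (GREATEST k. \<exists>Ts :: nat \<Rightarrow> nat set set.
      (\<forall>i<k. spanning_tree n E (Ts i)) \<and>
      (\<forall>i<k. \<forall>j<k. i \<noteq> j \<longrightarrow> Ts i \<inter> Ts j = {}))"

definition degree :: "nat set set \<Rightarrow> nat \<Rightarrow> nat" where
  "degree E v = card {u. {u, v} \<in> E \<and> u \<noteq> v}"

definition min_degree :: "nat \<Rightarrow> nat set set \<Rightarrow> nat" where
  "min_degree n E = Min (degree E ` {1..n})"

end

theory Submission
  imports Defs "HOL-Real_Asymp.Real_Asymp"
begin

text \<open>
  By the theorem of Nash-Williams and Tutte, a graph has T edge-disjoint spanning trees iff every
  partition of the vertices into t parts is crossed by at least T (t - 1) edges. Let m be the number
  of edges and T the claimed value. If no part contains more than 3n/4 vertices, the condition follows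
  from \<open>T (n - 1) \<le> m\<close> as soon as \<open>(n - 1) e(S) \<le> (|S| - 1) m\<close> for every part S. If one part contains more
  than 3n/4 vertices, with complement R, then \<open>t - 1 \<le> |R|\<close>, so it suffices that the boundary of
  R has at least \<open>T |R|\<close> edges.

  If \<open>n p \<ge> 640 ln n\<close>, Chernoff bounds and a union bound over all sets give both properties. Otherwise they
  do so only for sets of linear size. In smaller sets S one has \<open>e(S) \<le> c n p |S|\<close> with a tiny c, which
  settles the first property; for the second one let k be the least number for which the expected number
  of vertices of degree at most k is at least \<open>n powr 0.1\<close>. By the second moment method the minimum degree,
  and hence T, is at most k (so there is nothing to prove if k = 0), and vertices of degree at most
  \<open>k + \<eta> n p\<close> are so rare that no two of them are adjacent or have a common neighbour. All other vertices
  have degree at least \<open>T + \<eta> n p\<close>, which outweighs the edges inside R.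
\<close>

section \<open>Tree packing\<close>

text \<open>With d = n p, the ratio m / (n - 1) is about d / 2. A set of s \<le> 3n/4 vertices spans
  about p s^2 / 2 \<le> 0.375 d s edges, and a set of r \<le> n/4 vertices sends out about p r (n -
  r) \<ge> 0.75 d r. So the threshold 3n/4 leaves room on both sides, which the constants 0.475 and
  0.525 exploit. Density alone cannot treat a huge part: for S = V - {v} the inequality (n - 1) e(S)
  \<le> (|S| - 1) m says m \<le> (n - 1) deg v, which fails at any vertex of degree below m / (n -
  1). There the boundary has to be compared with T itself. For d of order ln n a vertex may have
  degree below d / 2 with probability above 1/n, so a union bound already fails for one-vertex sets.
  The exponent 0.1 balances two demands: n^0.1 must tend to infinity for the second moment method,
  while being light must have probability n^-c with c > 1/2, because n d + n d^2 counts the expected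
  adjacent pairs and pairs with a common neighbour up to constants. As p is an arbitrary function of
  n, both ranges may occur infinitely often; hence all error bounds depend on n alone.\<close>

abbreviation conn :: "nat set set \<Rightarrow> (nat \<times> nat) set" where
  "conn A \<equiv> (adj_rel A)\<^sup>*"

text \<open>For a two-element e this is membership in the closure of A in the graphic
  matroid.\<close>

definition spans :: "nat set set \<Rightarrow> nat set \<Rightarrow> bool" where
  "spans A e \<longleftrightarrow> (\<forall>x\<in>e. \<forall>y\<in>e. (x, y) \<in> conn A)"

text \<open>Independence in the graphic matroid, the form that exchange arguments work with;
  \<open>forest_no_cycle\<close> translates it into the absence of cycles.\<close>

definition forest :: "nat set set \<Rightarrow> bool" where
  "forest A \<longleftrightarrow> (\<forall>g\<in>A. \<not> spans (A - {g}) g)"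

lemma sym_conn: "sym (conn A)"
proof -
  have "sym (adj_rel A)"
    by (auto simp: adj_rel_def sym_def insert_commute)
  then show ?thesis by (rule sym_rtrancl)
qed

lemma conn_commute: "(x, y) \<in> conn A \<longleftrightarrow> (y, x) \<in> conn A"
  using sym_conn[of A] by (auto dest: symD)

lemma spans_pair [simp]: "spans A {x, y} \<longleftrightarrow> (x, y) \<in> conn A"
  by (auto simp: spans_def conn_commute)

lemma equiv_conn: "equiv UNIV (conn A)"
  by (simp add: equiv_def refl_rtrancl sym_conn trans_rtrancl)

text \<open>A path needs the new edge at most once, in one of two directions. The case x = y is
  allowed: \<open>adj_rel\<close> ignores loops, and the last two disjuncts then reduce to the first
  by transitivity.\<close>

lemma conn_insert:
  "(a, b) \<in> conn (insert {x, y} A) \<longleftrightarrow>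
     (a, b) \<in> conn A \<or> (a, x) \<in> conn A \<and> (y, b) \<in> conn A \<or> (a, y) \<in> conn A \<and> (x, b) \<in> conn A"
proof (cases "x = y")
  case True
  then have "adj_rel (insert {x, y} A) = adj_rel A"
    by (auto simp: adj_rel_def doubleton_eq_iff)
  with True show ?thesis by (auto intro: rtrancl_trans)
next
  case False
  then have *: "adj_rel (insert {x, y} A) = insert (x, y) (insert (y, x) (adj_rel A))"
    by (auto simp: adj_rel_def doubleton_eq_iff)
  show ?thesis
  proof
    assume "(a, b) \<in> conn (insert {x, y} A)"
    then show "(a, b) \<in> conn A \<or> (a, x) \<in> conn A \<and> (y, b) \<in> conn A \<or> (a, y) \<in> conn A \<and> (x, b) \<in> conn A"
      unfolding *
    proof (induction rule: rtrancl_induct)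
      case (step b c)
      then consider "(b, c) \<in> conn A" | "b = x" "c = y" | "b = y" "c = x" by auto
      then show ?case
        using step.IH conn_commute[of x y A] by cases (meson rtrancl.rtrancl_refl rtrancl_trans)+
    qed simp
  next
    have "conn A \<subseteq> conn (insert {x, y} A)"
      by (intro rtrancl_mono) (auto simp: adj_rel_def)
    moreover have "(x, y) \<in> conn (insert {x, y} A)" "(y, x) \<in> conn (insert {x, y} A)"
      unfolding * by auto
    moreover assume "(a, b) \<in> conn A \<or> (a, x) \<in> conn A \<and> (y, b) \<in> conn A \<or> (a, y) \<in> conn A \<and> (x, b) \<in> conn A"
    ultimately show "(a, b) \<in> conn (insert {x, y} A)"
      by (meson rtrancl_trans subsetD)
  qed
qed

lemma conn_mono: "A \<subseteq> B \<Longrightarrow> conn A \<subseteq> conn B"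
  by (intro rtrancl_mono) (auto simp: adj_rel_def)

lemma spans_mono: "spans A e \<Longrightarrow> A \<subseteq> B \<Longrightarrow> spans B e"
  using conn_mono[of A B] by (auto simp: spans_def)

lemma spans_member: "e \<in> A \<Longrightarrow> card e = 2 \<Longrightarrow> spans A e"
  by (auto simp: card_2_iff adj_rel_def)

lemma conn_subset_if_spans:
  assumes "\<And>e. e \<in> B \<Longrightarrow> spans A e"
  shows "conn B \<subseteq> conn A"
proof -
  have "adj_rel B \<subseteq> conn A"
    using assms by (force simp: adj_rel_def)
  then show ?thesis by (metis rtrancl_idemp rtrancl_mono)
qed

lemma spans_trans: "spans B e \<Longrightarrow> (\<And>g. g \<in> B \<Longrightarrow> spans A g) \<Longrightarrow> spans A e"
  using conn_subset_if_spans[of B A] by (auto simp: spans_def)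

text \<open>The Mac Lane-Steinitz exchange property: a path joining the ends of f must use g, and
  the rest of this path together with f joins the ends of g.\<close>

lemma spans_exchange:
  assumes "card f = 2" "card g = 2" "spans (insert g A) f" "\<not> spans A f"
  shows "spans (insert f A) g"
proof -
  obtain x y u v where [simp]: "f = {x, y}" "g = {u, v}"
    using assms(1,2) by (auto simp: card_2_iff)
  show ?thesis
    using assms(3,4) conn_commute[of _ _ A] by (auto simp: conn_insert)
qed

lemma forest_insert:
  assumes "forest A" "card f = 2" "\<And>g. g \<in> A \<Longrightarrow> card g = 2" "\<not> spans A f"
  shows "forest (insert f A)"
  unfolding forest_def
proof
  fix h assume h: "h \<in> insert f A"
  show "\<not> spans (insert f A - {h}) h"
  proof (cases "h = f")
    case True
    then show ?thesis
      using assms(4) spans_mono[of "insert f A - {h}" f A] by auto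
  next
    case False
    then have hA: "h \<in> A" and eq: "insert f A - {h} = insert f (A - {h})"
      using h by auto
    show ?thesis
    proof
      assume "spans (insert f A - {h}) h"
      then have "spans (insert h (A - {h})) f"
        using spans_exchange[of h f "A - {h}"] hA assms(1,2) assms(3)[of h]
        by (auto simp: eq forest_def)
      then show False using assms(4) hA by (simp add: insert_absorb)
    qed
  qed
qed

lemma forest_subset: "forest A \<Longrightarrow> B \<subseteq> A \<Longrightarrow> forest B"
  unfolding forest_def by (meson Diff_mono order_refl spans_mono subsetD)

text \<open>The edges of A whose removal separates the ends of f form the path between these ends,
  so together with f the fundamental circuit. No path is constructed: D is a minimal subset of A
  spanning f. Each g in D is indispensable in A as well, since by exchange g is spanned by f and D -
  {g}; if A - {g} spanned f, it would span g, against the forest property.\<close>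

lemma spans_circuit:
  assumes "finite A" "forest A" "\<And>g. g \<in> A \<Longrightarrow> card g = 2" "card f = 2" "spans A f"
    and S: "\<And>g. g \<in> A \<Longrightarrow> \<not> spans (A - {g}) f \<Longrightarrow> g \<in> S"
  shows "spans (A \<inter> S) f"
proof -
  define \<D> where "\<D> = {D. D \<subseteq> A \<and> spans D f}"
  have "finite \<D>" "\<D> \<noteq> {}"
    using assms(1,5) by (auto simp: \<D>_def)
  then obtain D where D: "D \<in> \<D>" and min: "\<And>D'. D' \<in> \<D> \<Longrightarrow> D' \<subseteq> D \<Longrightarrow> D = D'"
    using finite_has_minimal by metis
  have "D \<subseteq> S"
  proof
    fix g assume g: "g \<in> D"
    have nD: "\<not> spans (D - {g}) f"
      using min[of "D - {g}"] g D by (auto simp: \<D>_def)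
    have gA: "g \<in> A" using g D by (auto simp: \<D>_def)
    have "spans (insert f (D - {g})) g"
      using spans_exchange[of f g "D - {g}"] assms(3,4) gA nD D g
      by (simp add: insert_absorb \<D>_def)
    have "\<not> spans (A - {g}) f"
    proof
      assume f: "spans (A - {g}) f"
      have "spans (A - {g}) g"
        using \<open>spans (insert f (D - {g})) g\<close>
      proof (rule spans_trans)
        fix h assume "h \<in> insert f (D - {g})"
        then show "spans (A - {g}) h"
          using f D assms(3) by (cases "h = f") (auto simp: \<D>_def intro: spans_member)
      qed
      with assms(2) gA show False by (auto simp: forest_def)
    qed
    with S gA show "g \<in> S" by blast
  qed
  with D show ?thesis
    by (auto simp: \<D>_def intro: spans_mono[of D])
qed


section \<open>Components and the rank of an edge set\<close>

lemma quotient_conn_insert: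
  assumes "x \<in> V" "y \<in> V" "(x, y) \<notin> conn A"
  shows "V // conn (insert {x, y} A) =
     insert (conn A `` {x} \<union> conn A `` {y}) (V // conn A - {conn A `` {x}, conn A `` {y}})"
    (is "?L = ?R")
proof -
  have cl: "conn (insert {x, y} A) `` {v} =
      (if v \<in> conn A `` {x} \<union> conn A `` {y} then conn A `` {x} \<union> conn A `` {y} else conn A `` {v})" for v
    using conn_commute[of _ _ A] by (auto simp: conn_insert intro: rtrancl_trans)
  have eq: "conn A `` {v} = conn A `` {w} \<longleftrightarrow> (w, v) \<in> conn A" for v w
    using eq_equiv_class_iff[OF equiv_conn, of v w A] conn_commute[of v w A] by simp
  show ?thesis
  proof
    show "?L \<subseteq> ?R"
    proof
      fix c assume "c \<in> ?L"
      then obtain v where v: "v \<in> V" "c = conn (insert {x, y} A) `` {v}" by (rule quotientE)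
      show "c \<in> ?R"
      proof (cases "v \<in> conn A `` {x} \<union> conn A `` {y}")
        case True
        then show ?thesis using v(2) unfolding cl by simp
      next
        case False
        then have "c = conn A `` {v}" "c \<noteq> conn A `` {x}" "c \<noteq> conn A `` {y}"
          using v(2) unfolding cl by (simp_all add: eq)
        then show ?thesis using v(1) by (auto intro: quotientI)
      qed
    qed
    show "?R \<subseteq> ?L"
    proof
      fix c assume "c \<in> ?R"
      then consider "c = conn A `` {x} \<union> conn A `` {y}"
        | "c \<in> V // conn A" "c \<noteq> conn A `` {x}" "c \<noteq> conn A `` {y}" by auto
      then show "c \<in> ?L"
      proof cases
        case 1
        then have "c = conn (insert {x, y} A) `` {x}" by (simp add: cl)
        then show ?thesis using assms(1) by (auto simp: quotient_def)
      next
        case 2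
        then obtain v where v: "v \<in> V" "c = conn A `` {v}" by (auto simp: quotient_def)
        then have "c = conn (insert {x, y} A) `` {v}" using 2 by (auto simp: cl eq)
        then show ?thesis using v(1) by (auto simp: quotient_def)
      qed
    qed
  qed
qed

lemma card_quotient_conn_insert:
  assumes "finite V" "x \<in> V" "y \<in> V" "(x, y) \<notin> conn A"
  shows "card (V // conn A) = Suc (card (V // conn (insert {x, y} A)))"
proof -
  let ?x = "conn A `` {x}" and ?y = "conn A `` {y}"
  have fin: "finite (V // conn A)" using assms(1) by (auto simp: quotient_def)
  have eq: "conn A `` {v} = conn A `` {w} \<longleftrightarrow> (w, v) \<in> conn A" for v w
    using eq_equiv_class_iff[OF equiv_conn, of v w A] conn_commute[of v w A] by simp
  have mem: "{?x, ?y} \<subseteq> V // conn A" using assms by (auto simp: quotient_def)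
  have ne: "?x \<noteq> ?y" using assms(4) conn_commute[of x y A] by (simp add: eq)
  have "?x \<union> ?y \<notin> V // conn A"
  proof
    assume "?x \<union> ?y \<in> V // conn A"
    then obtain w where w: "?x \<union> ?y = conn A `` {w}" by (auto simp: quotient_def)
    then have "(w, x) \<in> conn A" "(w, y) \<in> conn A" by auto
    then have "?x = conn A `` {w}" "?y = conn A `` {w}" by (simp_all add: eq)
    with ne show False by simp
  qed
  then have "card (V // conn (insert {x, y} A)) = Suc (card (V // conn A - {?x, ?y}))"
    using fin assms by (simp add: quotient_conn_insert)
  moreover have "card (V // conn A - {?x, ?y}) + 2 = card (V // conn A)"
    using card_Diff_subset[OF _ mem] card_mono[OF fin mem] ne by simp
  ultimately show ?thesis by simp
qed

text \<open>The rank formula, by adding edges one at a time: an edge merges two components unless it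
  is already spanned, and in a forest every edge merges. Isolated vertices count as singleton
  classes because \<open>conn\<close> is reflexive.\<close>

lemma card_quotient_conn:
  assumes "finite A" "finite V" "\<And>e. e \<in> A \<Longrightarrow> e \<subseteq> V \<and> card e = 2"
  shows "card V \<le> card A + card (V // conn A)"
    and "forest A \<Longrightarrow> card A + card (V // conn A) = card V"
proof -
  have "card V \<le> card A + card (V // conn A) \<and>
    (forest A \<longrightarrow> card A + card (V // conn A) = card V)"
    using assms(1,3)
  proof (induction A)
    case empty
    have "adj_rel {} = {}" by (auto simp: adj_rel_def)
    then have "V // conn {} = (\<lambda>v. {v}) ` V" by (auto simp: quotient_def)
    then show ?case by (simp add: card_image)
  next
    case (insert e A)
    obtain x y where e: "e = {x, y}" and xy: "x \<in> V" "y \<in> V"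
      using insert.prems[of e] by (auto simp: card_2_iff)
    have IH: "card V \<le> card A + card (V // conn A)"
      "forest A \<Longrightarrow> card A + card (V // conn A) = card V"
      using insert by auto
    show ?case
    proof (cases "spans A e")
      case True
      have "conn (insert e A) = conn A"
        using True insert.prems
        by (intro equalityI conn_subset_if_spans) (auto intro: spans_member)
      moreover have "\<not> forest (insert e A)"
        using True insert.hyps by (auto simp: forest_def)
      ultimately show ?thesis using IH insert.hyps by simp
    next
      case False
      have "card (V // conn A) = Suc (card (V // conn (insert e A)))"
        using False card_quotient_conn_insert[OF assms(2) xy] e by simp
      moreover have "forest (insert e A) \<Longrightarrow> forest A"
        by (rule forest_subset) auto
      ultimately show ?thesis using IH insert.hyps by auto
    qed
  qed
  then show "card V \<le> card A + card (V // conn A)"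
    and "forest A \<Longrightarrow> card A + card (V // conn A) = card V" by auto
qed

section \<open>Maximum forest packings and edge swaps\<close>

definition packing :: "nat set set \<Rightarrow> nat \<Rightarrow> (nat \<Rightarrow> nat set set) \<Rightarrow> bool" where
  "packing E k F \<longleftrightarrow> (\<forall>i<k. F i \<subseteq> E \<and> forest (F i)) \<and>
     (\<forall>i<k. \<forall>j<k. i \<noteq> j \<longrightarrow> F i \<inter> F j = {})"

abbreviation uncovered :: "nat set set \<Rightarrow> nat \<Rightarrow> (nat \<Rightarrow> nat set set) \<Rightarrow> nat set set" where
  "uncovered E k F \<equiv> E - (\<Union>i<k. F i)"

lemma packing_disjoint: "packing E k F \<Longrightarrow> g \<in> F i \<Longrightarrow> i < k \<Longrightarrow> j < k \<Longrightarrow> i \<noteq> j \<Longrightarrow> g \<notin> F j"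
  unfolding packing_def by blast

lemma packing_upd:
  assumes "packing E k F" "j < k" "A \<subseteq> E" "forest A" "\<And>i. i < k \<Longrightarrow> i \<noteq> j \<Longrightarrow> F i \<inter> A = {}"
  shows "packing E k (F(j := A))"
  using assms unfolding packing_def by (auto simp: Int_commute)

text \<open>A step moves an uncovered edge f into F j in exchange for an edge g on the path of F j
  between the ends of f; that is what the last premise expresses once F j spans f. The total number
  of edges stays the same, so maximality is inherited.\<close>

inductive reach :: "nat set set \<Rightarrow> nat \<Rightarrow> (nat \<Rightarrow> nat set set) \<Rightarrow> (nat \<Rightarrow> nat set set) \<Rightarrow> bool"
  for E k F\<^sub>0 where
  reach_refl: "reach E k F\<^sub>0 F\<^sub>0"
| reach_step: "reach E k F\<^sub>0 F \<Longrightarrow> f \<in> uncovered E k F \<Longrightarrow> j < k \<Longrightarrow> g \<in> F j \<Longrightarrow>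
    \<not> spans (F j - {g}) f \<Longrightarrow> reach E k F\<^sub>0 (F(j := insert f (F j - {g})))"

locale maximal_packing =
  fixes E :: "nat set set" and k :: nat and F\<^sub>0 :: "nat \<Rightarrow> nat set set"
  assumes fin: "finite E" and edge: "\<And>e. e \<in> E \<Longrightarrow> card e = 2"
    and pack0: "packing E k F\<^sub>0"
    and maximal: "\<And>F. packing E k F \<Longrightarrow> (\<Sum>i<k. card (F i)) \<le> (\<Sum>i<k. card (F\<^sub>0 i))"
begin

lemma reach_packing:
  "reach E k F\<^sub>0 F \<Longrightarrow> packing E k F \<and> (\<Sum>i<k. card (F i)) = (\<Sum>i<k. card (F\<^sub>0 i))"
proof (induction rule: reach.induct)
  case reach_refl
  then show ?case using pack0 by simp
next
  case (reach_step F f j g)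
  have P: "packing E k F" using reach_step by blast
  have Fj: "F j \<subseteq> E" "forest (F j)" using P reach_step.hyps by (auto simp: packing_def)
  have "forest (insert f (F j - {g}))"
    using reach_step.hyps Fj edge forest_subset[OF Fj(2)] by (intro forest_insert) auto
  then have "packing E k (F(j := insert f (F j - {g})))"
    using P reach_step.hyps Fj packing_disjoint[OF P, of _ _ j] by (intro packing_upd) auto
  moreover have "card (insert f (F j - {g})) = card (F j)"
    using reach_step.hyps finite_subset[OF Fj(1) fin] by (simp add: card_Suc_Diff1 del: card_Diff_insert)
  then have "card ((F(j := insert f (F j - {g}))) i) = card (F i)" for i by simp
  ultimately show ?case using reach_step.IH by (simp del: fun_upd_apply)
qed

text \<open>Otherwise adding f to F j would enlarge a packing that already has the maximal total
  size.\<close>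

lemma reach_spans:
  assumes "reach E k F\<^sub>0 F" "f \<in> uncovered E k F" "j < k"
  shows "spans (F j) f"
proof (rule ccontr)
  assume n: "\<not> spans (F j) f"
  have P: "packing E k F" and sz: "(\<Sum>i<k. card (F i)) = (\<Sum>i<k. card (F\<^sub>0 i))"
    using reach_packing[OF assms(1)] by auto
  have Fj: "F j \<subseteq> E" "forest (F j)" using P assms by (auto simp: packing_def)
  have "forest (insert f (F j))"
    using n Fj edge assms by (intro forest_insert) auto
  then have "packing E k (F(j := insert f (F j)))"
    using P assms Fj by (intro packing_upd) (auto simp: packing_def)
  then have "(\<Sum>i<k. card ((F(j := insert f (F j))) i)) \<le> (\<Sum>i<k. card (F i))"
    using maximal sz by metis
  moreover have "(\<Sum>i<k. card ((F(j := insert f (F j))) i)) > (\<Sum>i<k. card (F i))"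
    using assms finite_subset[OF Fj(1) fin] by (intro sum_strict_mono_ex1) (auto intro!: bexI[of _ j])
  ultimately show False by simp
qed

text \<open>The exchange argument uses single swaps only: instead of augmenting along a shortest path inside
  one packing, it collects the edges left uncovered by \<^emph>\<open>any\<close> packing reachable by swaps.\<close>

definition swappable :: "nat set set" where
  "swappable = {f. \<exists>F. reach E k F\<^sub>0 F \<and> f \<in> uncovered E k F}"

text \<open>Each edge g on the path of F j between the ends of f can be swapped out for f and is
  then uncovered. So the whole path consists of swappable edges, and \<open>spans_circuit\<close>
  applies.\<close>

lemma reach_spans_swappable:
  assumes "reach E k F\<^sub>0 F" "f \<in> uncovered E k F" "j < k"
  shows "spans (F j \<inter> swappable) f"
proof (rule spans_circuit)
  have P: "packing E k F" using reach_packing[OF assms(1)] by auto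
  have Fj: "F j \<subseteq> E" "forest (F j)" using P assms by (auto simp: packing_def)
  show "finite (F j)" using Fj(1) fin by (rule finite_subset)
  show "forest (F j)" by fact
  show "card g = 2" if "g \<in> F j" for g using that Fj edge by auto
  show "card f = 2" using assms edge by auto
  show "spans (F j) f" using assms by (rule reach_spans)
  fix g assume g: "g \<in> F j" "\<not> spans (F j - {g}) f"
  let ?F = "F(j := insert f (F j - {g}))"
  have r: "reach E k F\<^sub>0 ?F" using assms g by (intro reach_step)
  have "g \<noteq> f" using assms g by auto
  moreover have "g \<notin> F i" if "i < k" "i \<noteq> j" for i
    using packing_disjoint[OF P g(1)] that assms by auto
  ultimately have "g \<in> uncovered E k ?F" using g Fj by auto
  with r show "g \<in> swappable" unfolding swappable_def by blast
qed

text \<open>For the forest that is swapped, \<open>reach_spans_swappable\<close> is used twice: for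
  f in the packing before the swap, and for g in the packing after it, where g is the uncovered
  edge. So the two restrictions to \<open>swappable\<close> span each other.\<close>

lemma reach_conn:
  "reach E k F\<^sub>0 F \<Longrightarrow> j < k \<Longrightarrow> conn (F j \<inter> swappable) = conn (F\<^sub>0 j \<inter> swappable)"
proof (induction rule: reach.induct)
  case reach_refl
  show ?case by simp
next
  case (reach_step F f i g)
  let ?F = "F(i := insert f (F i - {g}))"
  show ?case
  proof (cases "i = j")
    case True
    have P: "packing E k F" using reach_packing[OF reach_step.hyps(1)] by auto
    have Fj: "F j \<subseteq> E" using P reach_step.prems by (auto simp: packing_def)
    have r: "reach E k F\<^sub>0 ?F" using reach_step.hyps by (intro reach.reach_step)
    have "g \<noteq> f" using reach_step.hyps by auto
    moreover have "g \<notin> F l" if "l < k" "l \<noteq> j" for l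
      using packing_disjoint[OF P] reach_step.hyps that True by auto
    ultimately have g: "g \<in> uncovered E k ?F" using reach_step.hyps True Fj by auto
    have "conn (?F j \<inter> swappable) = conn (F j \<inter> swappable)"
    proof (intro equalityI conn_subset_if_spans)
      fix e assume "e \<in> ?F j \<inter> swappable"
      then consider "e = f" | "e \<in> F j \<inter> swappable" using True by auto
      then show "spans (F j \<inter> swappable) e"
        using reach_spans_swappable[OF reach_step.hyps(1,2) reach_step.prems] Fj edge spans_member
        by cases auto
    next
      fix e assume e: "e \<in> F j \<inter> swappable"
      then consider "e = g" | "e \<in> ?F j \<inter> swappable" using True by auto
      then show "spans (?F j \<inter> swappable) e"
        using reach_spans_swappable[OF r g reach_step.prems] Fj edge e spans_member[of e "?F j \<inter> swappable"]
        by cases blast+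
    qed
    then show ?thesis using reach_step by simp
  next
    case False
    then show ?thesis using reach_step by simp
  qed
qed

text \<open>A swappable edge is uncovered in some reachable packing, hence spanned there by the
  swappable edges of each member, and swaps do not change what these connect. So every
  \<open>F\<^sub>0 j\<close> contains a spanning forest of the graph \<open>swappable\<close>, whose
  components form the critical partition.\<close>

lemma conn_swappable: "j < k \<Longrightarrow> conn (F\<^sub>0 j \<inter> swappable) = conn swappable"
proof (intro equalityI)
  assume j: "j < k"
  show "conn swappable \<subseteq> conn (F\<^sub>0 j \<inter> swappable)"
  proof (rule conn_subset_if_spans)
    fix f assume "f \<in> swappable"
    then obtain F where F: "reach E k F\<^sub>0 F" "f \<in> uncovered E k F" unfolding swappable_def by blast
    then show "spans (F\<^sub>0 j \<inter> swappable) f"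
      using reach_spans_swappable[OF F j] reach_conn[OF F(1) j] by (auto simp: spans_def)
  qed
qed (rule conn_mono, blast)

end

text \<open>Every partition that matters is the partition into the components of some subgraph B.\<close>

theorem nash_williams_tutte:
  assumes "finite V" "finite E" and edge: "\<And>e. e \<in> E \<Longrightarrow> e \<subseteq> V \<and> card e = 2"
    and cut: "\<And>B. B \<subseteq> E \<Longrightarrow> k * (card (V // conn B) - 1) \<le> card {e \<in> E. \<not> spans B e}"
  obtains F where "packing E k F" "\<And>i. i < k \<Longrightarrow> connected_on V (F i)"
proof (cases "V = {}")
  case True
  then show thesis using that[of "\<lambda>_. {}"] by (auto simp: packing_def forest_def connected_on_def)
next
  case False
  let ?size = "\<lambda>F. \<Sum>i<k. card (F i :: nat set set)"
  have empty: "packing E k (\<lambda>_. {})" by (auto simp: packing_def forest_def)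
  have bound: "?size F \<le> k * card E" if "packing E k F" for F
    using that assms(2) sum_bounded_above[of "{..<k}" "\<lambda>i. card (F i)" "card E"]
    by (auto simp: packing_def card_mono)
  have "\<exists>F. packing E k F \<and> (\<forall>F'. packing E k F' \<longrightarrow> ?size F' \<le> ?size F)"
    using ex_has_greatest_nat[of "packing E k" "\<lambda>_. {}" ?size "Suc (k * card E)"] empty bound
    by (auto simp: less_Suc_eq_le)
  then obtain F where F: "packing E k F" and max: "\<And>F'. packing E k F' \<Longrightarrow> ?size F' \<le> ?size F"
    by blast
  interpret maximal_packing E k F
    by unfold_locales (use assms edge F max in auto)
  have FE: "F i \<subseteq> E" "forest (F i)" if "i < k" for i using F that by (auto simp: packing_def)
  have finF: "finite (F i)" if "i < k" for i using FE(1)[OF that] assms(2) by (rule finite_subset)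
  have cnt: "card (F i \<inter> B) + card (V // conn (F i \<inter> B)) = card V" if "i < k" for i B
  proof (rule card_quotient_conn(2))
    show "forest (F i \<inter> B)" using FE(2)[OF that] by (rule forest_subset) auto
    show "e \<subseteq> V \<and> card e = 2" if "e \<in> F i \<inter> B" for e
      using that FE(1)[OF \<open>i < k\<close>] assms(3) by blast
  qed (use finF[OF that] assms(1) in auto)
  have pos: "card (V // conn B) > 0" for B
    using False assms(1) by (auto simp: card_gt_0_iff quotient_def)
  have le: "card (F i) \<le> card V - 1" if "i < k" for i
    using cnt[OF that, of UNIV] pos[of "F i"] by simp
  have "?size F = k * (card V - 1)"
  proof (rule ccontr)
    assume "?size F \<noteq> k * (card V - 1)"
    moreover have "?size F \<le> k * (card V - 1)"
      using sum_bounded_above[of "{..<k}" "\<lambda>i. card (F i)" "card V - 1"] le by auto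
    ultimately have less: "?size F < k * (card V - 1)" by simp
    have swap_sub: "swappable \<subseteq> E" by (auto simp: swappable_def)
    \<comment> \<open>Each F i has |V| - c edges in \<open>swappable\<close>, where c is the number
      of components, so a packing that is too small has fewer than k (c - 1) edges outside it. All
      edges between components are covered by these, against \<open>cut\<close> for B =
      \<open>swappable\<close>.\<close>
    let ?c = "card (V // conn swappable)"
    have "{e \<in> E. \<not> spans swappable e} \<subseteq> (\<Union>i<k. F i - swappable)"
    proof
      fix e assume e: "e \<in> {e \<in> E. \<not> spans swappable e}"
      then have "e \<notin> swappable" using edge spans_member by auto
      then have "e \<notin> uncovered E k F" using reach_refl[of E k F] by (auto simp: swappable_def)
      then show "e \<in> (\<Union>i<k. F i - swappable)" using e \<open>e \<notin> swappable\<close> by auto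
    qed
    then have "card {e \<in> E. \<not> spans swappable e} \<le> card (\<Union>i<k. F i - swappable)"
      using finF by (intro card_mono) auto
    also have "\<dots> \<le> (\<Sum>i<k. card (F i - swappable))" by (rule card_UN_le) simp
    finally have 1: "card {e \<in> E. \<not> spans swappable e} \<le> (\<Sum>i<k. card (F i - swappable))" .
    have "card (F i - swappable) + (card V - ?c) = card (F i)" if "i < k" for i
      using cnt[OF that, of swappable] conn_swappable[OF that] card_Int_Diff[OF finF[OF that], of swappable]
      by simp
    then have "?size F = (\<Sum>i<k. card (F i - swappable) + (card V - ?c))" by simp
    also have "\<dots> = (\<Sum>i<k. card (F i - swappable)) + k * (card V - ?c)" by (simp add: sum.distrib)
    finally have "(\<Sum>i<k. card (F i - swappable)) + k * (card V - ?c) < k * (card V - 1)"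
      using less by simp
    moreover have "k * (?c - 1) \<le> (\<Sum>i<k. card (F i - swappable))"
      using cut[OF swap_sub] 1 by linarith
    ultimately have "k * (?c - 1) + k * (card V - ?c) < k * (card V - 1)" by linarith
    moreover have "?c \<le> card V" using assms(1)
      by (auto simp: quotient_def UN_singleton intro!: order_trans[OF card_UN_le])
    then have "(?c - 1) + (card V - ?c) = card V - 1" using pos[of swappable] by simp
    ultimately show False by (metis add_mult_distrib2 less_irrefl)
  qed
  then have tight: "card (F i) = card V - 1" if "i < k" for i
    using sum_mono_inv[of "\<lambda>i. card (F i)" "{..<k}" "\<lambda>_. card V - 1" i] le that by simp
  then have one: "card (V // conn (F i)) = 1" if "i < k" for i
    using cnt[OF that, of UNIV] tight[OF that] False assms(1) card_gt_0_iff[of V] by simp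
  have "connected_on V (F i)" if "i < k" for i
    unfolding connected_on_def
  proof (intro ballI)
    fix u v assume "u \<in> V" "v \<in> V"
    then have "conn (F i) `` {u} = conn (F i) `` {v}"
      using one[OF that] card_1_singletonE[of "V // conn (F i)"] quotientI[of _ V "conn (F i)"]
      by (metis singletonD)
    then show "(u, v) \<in> conn (F i)" by blast
  qed
  with F that show thesis by blast
qed

section \<open>Spanning trees of [n] and the cut condition\<close>

lemma all_edges_iff: "e \<in> all_edges n \<longleftrightarrow> e \<subseteq> {1..n} \<and> card e = 2"
  unfolding all_edges_def card_2_iff by blast

lemma finite_all_edges [simp]: "finite (all_edges n)"
proof (rule finite_subset)
  show "all_edges n \<subseteq> Pow {1..n}" using all_edges_iff by blast
qed simp

text \<open>The edge closing a cycle is spanned by the others. Distinctness and length at least 3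
  ensure that it does not occur among them; with two vertices it would.\<close>

lemma forest_no_cycle:
  assumes "forest T"
  shows "\<not> has_cycle T"
proof
  assume "has_cycle T"
  then obtain vs where L: "length vs \<ge> 3" and d: "distinct vs"
    and T: "\<And>i. i < length vs \<Longrightarrow> {vs ! i, vs ! ((i + 1) mod length vs)} \<in> T"
    unfolding has_cycle_def by blast
  let ?l = "length vs - 1"
  let ?e = "{vs ! ?l, vs ! 0}"
  have "?l + 1 = length vs" using L by simp
  then have "(?l + 1) mod length vs = 0" by simp
  then have e: "?e \<in> T" using T[of ?l] L by (metis diff_less less_le_trans zero_less_numeral zero_less_one)
  have "(vs ! 0, vs ! j) \<in> conn (T - {?e})" if "j \<le> ?l" for j
    using that
  proof (induction j)
    case (Suc j)
    have "{vs ! j, vs ! Suc j} \<in> T" using T[of j] Suc.prems L by simp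
    moreover have "{vs ! j, vs ! Suc j} \<noteq> ?e"
    proof
      assume "{vs ! j, vs ! Suc j} = ?e"
      then have "vs ! j = vs ! ?l \<or> vs ! j = vs ! 0 \<and> vs ! Suc j = vs ! ?l"
        by (auto simp: doubleton_eq_iff)
      moreover have "j < length vs" "Suc j < length vs" "?l < length vs" "0 < length vs"
        using Suc.prems L by auto
      ultimately show False
        using nth_eq_iff_index_eq[OF d] Suc.prems L by fastforce
    qed
    moreover have "vs ! j \<noteq> vs ! Suc j"
      using nth_eq_iff_index_eq[OF d] Suc.prems L by auto
    ultimately have "(vs ! j, vs ! Suc j) \<in> adj_rel (T - {?e})" by (auto simp: adj_rel_def)
    with Suc show ?case by (auto intro: rtrancl_into_rtrancl)
  qed simp
  then have "spans (T - {?e}) ?e" unfolding spans_pair conn_commute[of "vs ! ?l"] by simp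
  with e assms show False unfolding forest_def by blast
qed

lemma conn_class_subset:
  assumes "\<And>e. e \<in> B \<Longrightarrow> e \<subseteq> V" "(v, w) \<in> conn B" "v \<in> V"
  shows "w \<in> V"
  using assms(2,3) by (induction rule: rtrancl_induct) (use assms(1) in \<open>auto simp: adj_rel_def\<close>)

definition inner_edges :: "nat set set \<Rightarrow> nat set \<Rightarrow> nat set set" where
  "inner_edges E S = {e \<in> E. e \<subseteq> S}"

definition boundary :: "nat set set \<Rightarrow> nat set \<Rightarrow> nat set set" where
  "boundary E R = {e \<in> E. e \<inter> R \<noteq> {} \<and> \<not> e \<subseteq> R}"

text \<open>Here N is n - 1, s the sum of |C| - 1 over the parts C, p the number of parts minus 1, x
  the number of crossing edges and y that of inner ones. Then x \<ge> m - y \<ge> m - s m / N = p m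
  / N \<ge> T p.\<close>

lemma cut_weight:
  fixes N :: nat
  assumes "N = s + p" "m \<le> x + y" "N * y \<le> s * m" "T * N \<le> m" "N > 0"
  shows "T * p \<le> x"
proof -
  have "s * m + p * m = N * m" by (simp add: assms(1) distrib_right)
  also have "\<dots> \<le> N * (x + y)" using assms(2) by (rule mult_left_mono) simp
  also have "\<dots> \<le> N * x + s * m" using assms(3) by (simp add: distrib_left)
  finally have "p * m \<le> N * x" by simp
  moreover have "p * (T * N) \<le> p * m" using assms(4) by (rule mult_left_mono) simp
  moreover have "p * (T * N) = N * (T * p)" by simp
  ultimately have "N * (T * p) \<le> N * x" by linarith
  then show ?thesis using assms(5) nat_mult_le_cancel1 by blast
qed

lemma cut_condition:
  fixes n :: nat
  defines "V \<equiv> {1..n}"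
  assumes n: "n \<ge> 2" and E: "E \<subseteq> all_edges n" and T: "T * (n - 1) \<le> card E"
    and inner: "\<And>S. S \<subseteq> V \<Longrightarrow> S \<noteq> {} \<Longrightarrow> 4 * card S \<le> 3 * n \<Longrightarrow>
      (n - 1) * card (inner_edges E S) \<le> (card S - 1) * card E"
    and boundary: "\<And>R. R \<subseteq> V \<Longrightarrow> R \<noteq> {} \<Longrightarrow> 4 * card R < n \<Longrightarrow>
      T * card R \<le> card (boundary E R)"
    and B: "B \<subseteq> E"
  shows "T * (card (V // conn B) - 1) \<le> card {e \<in> E. \<not> spans B e}"
proof -
  let ?P = "V // conn B" and ?X = "{e \<in> E. \<not> spans B e}"
  have finE: "finite E" using E finite_all_edges by (rule finite_subset)
  have edge: "e \<subseteq> V" "card e = 2" if "e \<in> E" for e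
    using that E all_edges_iff[of e n] unfolding V_def by blast+
  have finV: "finite V" "card V = n" by (auto simp: V_def)
  have BV: "e \<subseteq> V" if "e \<in> B" for e using that B edge by blast
  have PV: "C \<subseteq> V" "C \<noteq> {}" if "C \<in> ?P" for C
    using that conn_class_subset[OF BV] by (auto elim!: quotientE)
  have finP: "finite ?P" using finV by (auto simp: quotient_def)
  have finC: "finite C" if "C \<in> ?P" for C using PV[OF that] finV by (auto intro: finite_subset)
  have UP: "\<Union>?P = V" using PV by (force simp: quotient_def)
  have dis: "C \<inter> D = {}" if "C \<in> ?P" "D \<in> ?P" "C \<noteq> D" for C D
  proof -
    have "?P \<subseteq> UNIV // conn B" by (auto simp: quotient_def)
    then show ?thesis using quotient_disj[OF equiv_conn, of C B D] that by blast
  qed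
  then have pdis: "pairwise disjnt Q" if "Q \<subseteq> ?P" for Q
    using that unfolding pairwise_def disjnt_def by blast
  have sp: "spans B e \<longleftrightarrow> (\<exists>C\<in>?P. e \<subseteq> C)" if e: "e \<in> E" for e
  proof -
    obtain x y where xy: "e = {x, y}" "x \<in> V" using edge[OF e] by (auto simp: card_2_iff)
    show ?thesis
    proof
      assume "spans B e"
      then have "e \<subseteq> conn B `` {x}" using xy by simp
      then show "\<exists>C\<in>?P. e \<subseteq> C" using xy by (auto intro: quotientI)
    next
      assume "\<exists>C\<in>?P. e \<subseteq> C"
      then obtain v where "(v, x) \<in> conn B" "(v, y) \<in> conn B" using xy by (auto elim!: quotientE)
      then have "(x, y) \<in> conn B" using conn_commute[of v x B] rtrancl_trans by metis
      then show "spans B e" using xy by simp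
    qed
  qed
  show ?thesis
  proof (cases "\<exists>C\<in>?P. 4 * card C > 3 * n")
    case True
    then obtain C where C: "C \<in> ?P" "4 * card C > 3 * n" by blast
    let ?R = "V - C"
    have R: "?R = \<Union>(?P - {C})"
    proof (intro equalityI subsetI)
      fix x assume x: "x \<in> ?R"
      then obtain D where "D \<in> ?P" "x \<in> D" by (metis DiffD1 UP UnionE)
      then show "x \<in> \<Union>(?P - {C})" using x by (intro UnionI[of D]) auto
    next
      fix x assume "x \<in> \<Union>(?P - {C})"
      then obtain D where D: "D \<in> ?P" "D \<noteq> C" "x \<in> D" by blast
      then have "x \<in> V" "x \<notin> C" using PV(1)[OF D(1)] dis[OF D(1) C(1) D(2)] by auto
      then show "x \<in> ?R" by simp
    qed
    have "card (?P - {C}) = (\<Sum>D\<in>?P - {C}. 1)" by simp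
    also have "\<dots> \<le> (\<Sum>D\<in>?P - {C}. card D)"
      using PV finC by (intro sum_mono) (simp add: card_gt_0_iff Suc_leI)
    also have "\<dots> = card ?R"
      unfolding R using finC by (intro card_Union_disjoint[symmetric] pdis) auto
    finally have tR: "card ?P - 1 \<le> card ?R" using C finP by simp
    have "card ?R = n - card C" using PV[OF C(1)] finC[OF C(1)] finV by (simp add: card_Diff_subset)
    then have R4: "4 * card ?R < n" using C card_mono[OF finV(1) PV(1)[OF C(1)]] finV by linarith
    show ?thesis
    proof (cases "?R = {}")
      case True
      then have "card ?R = 0" by (simp only: card.empty)
      with tR show ?thesis by simp
    next
      case False
      have "boundary E ?R \<subseteq> ?X"
      proof
        fix e assume e: "e \<in> boundary E ?R"
        then have eE: "e \<in> E" and "e \<inter> C \<noteq> {}" "\<not> e \<subseteq> C"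
          using edge by (auto simp: boundary_def)
        then have "\<not> e \<subseteq> D" if "D \<in> ?P" for D
          using dis[OF C(1) that] by (cases "C = D") auto
        with eE show "e \<in> ?X" by (simp add: sp)
      qed
      then have "card (boundary E ?R) \<le> card ?X" using finE by (intro card_mono) auto
      moreover have "T * card ?R \<le> card (boundary E ?R)"
        using False R4 by (intro boundary) auto
      moreover have "T * (card ?P - 1) \<le> T * card ?R" using tR by simp
      ultimately show ?thesis by linarith
    qed
  next
    case False
    let ?m = "card E"
    have "E = ?X \<union> (\<Union>C\<in>?P. inner_edges E C)" by (auto simp: sp inner_edges_def)
    then have "?m \<le> card ?X + card (\<Union>C\<in>?P. inner_edges E C)" by (metis card_Un_le)
    also have "card (\<Union>C\<in>?P. inner_edges E C) \<le> (\<Sum>C\<in>?P. card (inner_edges E C))"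
      using finP by (rule card_UN_le)
    finally have 1: "?m \<le> card ?X + (\<Sum>C\<in>?P. card (inner_edges E C))" by simp
    have 2: "(n - 1) * (\<Sum>C\<in>?P. card (inner_edges E C)) \<le> (\<Sum>C\<in>?P. (card C - 1)) * ?m"
      unfolding sum_distrib_left sum_distrib_right
    proof (rule sum_mono)
      fix C assume "C \<in> ?P"
      then show "(n - 1) * card (inner_edges E C) \<le> (card C - 1) * ?m"
        using False PV[of C] by (intro inner) (auto simp: not_less)
    qed
    have 3: "(\<Sum>C\<in>?P. (card C - 1)) + card ?P = n"
    proof -
      have "(\<Sum>C\<in>?P. (card C - 1)) + card ?P = (\<Sum>C\<in>?P. (card C - 1) + 1)"
        by (simp only: sum.distrib card_eq_sum)
      also have "\<dots> = (\<Sum>C\<in>?P. card C)"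
        using PV finC by (intro sum.cong) (auto simp: card_gt_0_iff Suc_leI)
      also have "\<dots> = card (\<Union>?P)"
        using finC by (intro card_Union_disjoint[symmetric] pdis) auto
      finally show ?thesis using UP finV by simp
    qed
    let ?s = "\<Sum>C\<in>?P. (card C - 1)"
    have "?P \<noteq> {}" using n by (auto simp: V_def)
    then have "card ?P > 0" using finP by (simp add: card_gt_0_iff)
    with 3 have n1: "n - 1 = ?s + (card ?P - 1)" by linarith
    show ?thesis
      by (rule cut_weight[OF n1 1 2 T]) (use n in simp)
  qed
qed

lemma degree_eq_card_incident:
  assumes "E \<subseteq> all_edges n"
  shows "degree E v = card {e \<in> E. v \<in> e}"
  unfolding degree_def
proof (rule bij_betw_same_card[of "\<lambda>u. {u, v}"], unfold bij_betw_def, intro conjI)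
  show "inj_on (\<lambda>u. {u, v}) {u. {u, v} \<in> E \<and> u \<noteq> v}"
    by (auto simp: inj_on_def doubleton_eq_iff)
  show "(\<lambda>u. {u, v}) ` {u. {u, v} \<in> E \<and> u \<noteq> v} = {e \<in> E. v \<in> e}"
  proof (intro equalityI subsetI)
    fix e assume e: "e \<in> {e \<in> E. v \<in> e}"
    then obtain u where "e = {u, v}" "u \<noteq> v"
      using assms by (auto simp: all_edges_def)
    with e show "e \<in> (\<lambda>u. {u, v}) ` {u. {u, v} \<in> E \<and> u \<noteq> v}" by auto
  qed auto
qed

text \<open>The upper bound for any packing: each member needs n - 1 edges to connect [n] and at
  least one edge at v, and by disjointness these edges add up.\<close>

lemma disjoint_trees_bounds:
  assumes n: "n \<ge> 2" and E: "E \<subseteq> all_edges n"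
    and Ts: "\<And>i. i < k \<Longrightarrow> spanning_tree n E (Ts i)"
    and dis: "\<And>i j. i < k \<Longrightarrow> j < k \<Longrightarrow> i \<noteq> j \<Longrightarrow> Ts i \<inter> Ts j = {}"
  shows "k * (n - 1) \<le> card E" and "v \<in> {1..n} \<Longrightarrow> k \<le> degree E v"
proof -
  let ?V = "{1..n}"
  have finE: "finite E" using E finite_all_edges by (rule finite_subset)
  have TE: "Ts i \<subseteq> E" and conT: "connected_on ?V (Ts i)" if "i < k" for i
    using Ts[OF that] by (auto simp: spanning_tree_def)
  have finT: "finite (Ts i)" if "i < k" for i using TE[OF that] finE by (rule finite_subset)
  have cT: "n - 1 \<le> card (Ts i)" if "i < k" for i
  proof -
    have "card ?V \<le> card (Ts i) + card (?V // conn (Ts i))"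
      using finT[OF that] TE[OF that] E all_edges_iff[of _ n] by (intro card_quotient_conn(1)) blast+
    moreover have "?V // conn (Ts i) \<subseteq> {conn (Ts i) `` {1}}"
    proof
      fix c assume "c \<in> ?V // conn (Ts i)"
      then obtain v where v: "v \<in> ?V" "c = conn (Ts i) `` {v}" by (rule quotientE)
      then have "(1, v) \<in> conn (Ts i)" using conT[OF that] n by (auto simp: connected_on_def)
      then show "c \<in> {conn (Ts i) `` {1}}"
        using equiv_class_eq[OF equiv_conn] v by simp
    qed
    then have "card (?V // conn (Ts i)) \<le> 1"
      using card_mono[of "{conn (Ts i) `` {1}}" "?V // conn (Ts i)"] by simp
    ultimately show ?thesis by simp
  qed
  have "k * (n - 1) \<le> (\<Sum>i<k. card (Ts i))"
    using sum_bounded_below[of "{..<k}" "n - 1" "\<lambda>i. card (Ts i)"] cT by simp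
  also have "\<dots> = card (\<Union>i<k. Ts i)"
    using finT dis by (intro card_UN_disjoint[symmetric]) auto
  also have "\<dots> \<le> card E" using TE finE by (intro card_mono) auto
  finally show "k * (n - 1) \<le> card E" .
  assume v: "v \<in> ?V"
  have "\<exists>e. e \<in> Ts i \<and> v \<in> e" if "i < k" for i
  proof -
    obtain w where w: "w \<in> ?V" "w \<noteq> v"
    proof (cases "v = 1")
      case True
      then show thesis using that[of 2] n by simp
    next
      case False
      then show thesis using that[of 1] n by simp
    qed
    then have "(v, w) \<in> conn (Ts i)" using conT[OF that] v by (auto simp: connected_on_def)
    then obtain u where "(v, u) \<in> adj_rel (Ts i)" using w by (metis converse_rtranclE)
    then show ?thesis by (auto simp: adj_rel_def)
  qed
  then obtain e where e: "\<And>i. i < k \<Longrightarrow> e i \<in> Ts i \<and> v \<in> e i" by metis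
  have "inj_on e {..<k}"
  proof (rule inj_onI)
    fix i j assume "i \<in> {..<k}" "j \<in> {..<k}" "e i = e j"
    then show "i = j" using e[of i] e[of j] dis[of i j] by auto
  qed
  then have "k = card (e ` {..<k})" by (simp add: card_image)
  also have "\<dots> \<le> card {e \<in> E. v \<in> e}"
    using e TE finE by (intro card_mono) auto
  finally show "k \<le> degree E v" using E by (simp add: degree_eq_card_incident)
qed

lemma tree_packing_eqI:
  fixes n :: nat
  defines "V \<equiv> {1..n}"
  assumes n: "n \<ge> 2" and E: "E \<subseteq> all_edges n"
    and T: "T = min (min_degree n E) (card E div (n - 1))"
    and inner: "\<And>S. T > 0 \<Longrightarrow> S \<subseteq> V \<Longrightarrow> S \<noteq> {} \<Longrightarrow> 4 * card S \<le> 3 * n \<Longrightarrow>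
      (n - 1) * card (inner_edges E S) \<le> (card S - 1) * card E"
    and boundary: "\<And>R. T > 0 \<Longrightarrow> R \<subseteq> V \<Longrightarrow> R \<noteq> {} \<Longrightarrow> 4 * card R < n \<Longrightarrow>
      T * card R \<le> card (boundary E R)"
  shows "tree_packing n E = T"
proof -
  have finE: "finite E" using E finite_all_edges by (rule finite_subset)
  have "T * (n - 1) \<le> (card E div (n - 1)) * (n - 1)" unfolding T by (intro mult_right_mono) auto
  also have "\<dots> \<le> card E" by simp
  finally have Tm: "T * (n - 1) \<le> card E" .
  have "T * (card (V // conn B) - 1) \<le> card {e \<in> E. \<not> spans B e}" if "B \<subseteq> E" for B
  proof (cases "T = 0")
    case False
    then show ?thesis
      using cut_condition[OF n E Tm _ _ that] inner boundary unfolding V_def by blast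
  qed simp
  moreover have "e \<subseteq> V \<and> card e = 2" if "e \<in> E" for e
    using that E all_edges_iff[of e n] unfolding V_def by blast
  ultimately obtain F where F: "packing E T F" and con: "\<And>i. i < T \<Longrightarrow> connected_on V (F i)"
    using nash_williams_tutte[of V E T thesis] finE V_def by blast
  then have st: "spanning_tree n E (F i)" if "i < T" for i
    using that con[OF that] F forest_no_cycle[of "F i"]
    unfolding packing_def spanning_tree_def V_def by blast
  show ?thesis
    unfolding tree_packing_def
  proof (rule Greatest_equality)
    show "\<exists>Ts. (\<forall>i<T. spanning_tree n E (Ts i)) \<and>
        (\<forall>i<T. \<forall>j<T. i \<noteq> j \<longrightarrow> Ts i \<inter> Ts j = {})"
      using st F unfolding packing_def by blast
  next
    fix k :: nat assume "\<exists>Ts. (\<forall>i<k. spanning_tree n E (Ts i)) \<and>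
        (\<forall>i<k. \<forall>j<k. i \<noteq> j \<longrightarrow> Ts i \<inter> Ts j = {})"
    then obtain Ts where Ts: "\<And>i. i < k \<Longrightarrow> spanning_tree n E (Ts i)"
      "\<And>i j. i < k \<Longrightarrow> j < k \<Longrightarrow> i \<noteq> j \<Longrightarrow> Ts i \<inter> Ts j = {}" by blast
    note b = disjoint_trees_bounds[OF n E Ts]
    have "k \<le> card E div (n - 1)" using b(1) n by (simp add: less_eq_div_iff_mult_less_eq)
    moreover have "k \<le> min_degree n E"
      unfolding min_degree_def using b(2) n by (subst Min_ge_iff) auto
    ultimately show "k \<le> T" by (simp add: T)
  qed
qed

section \<open>Random subsets of a finite set\<close>

text \<open>The expectation of g over a random subset of F that contains each element independently
  with probability p; for F = \<open>all_edges n\<close> this is the model G(n,p).\<close>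

definition bexp :: "'a set \<Rightarrow> real \<Rightarrow> ('a set \<Rightarrow> real) \<Rightarrow> real" where
  "bexp F p g = (\<Sum>A\<in>Pow F. p ^ card A * (1 - p) ^ card (F - A) * g A)"

definition bprob :: "'a set \<Rightarrow> real \<Rightarrow> ('a set \<Rightarrow> bool) \<Rightarrow> real" where
  "bprob F p Q = bexp F p (\<lambda>A. of_bool (Q A))"

lemma bexp_cong: "(\<And>A. A \<subseteq> F \<Longrightarrow> g A = h A) \<Longrightarrow> bexp F p g = bexp F p h"
  unfolding bexp_def by (intro sum.cong) auto

lemma bexp_empty [simp]: "bexp {} p g = g {}"
  by (simp add: bexp_def)

lemma bexp_add: "bexp F p (\<lambda>A. g A + h A) = bexp F p g + bexp F p h"
  by (simp add: bexp_def sum.distrib distrib_left)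

lemma bexp_cmult: "bexp F p (\<lambda>A. c * g A) = c * bexp F p g"
  unfolding bexp_def sum_distrib_left by (intro sum.cong) auto

lemma bexp_multc: "bexp F p (\<lambda>A. g A * c) = bexp F p g * c"
  unfolding bexp_def sum_distrib_right by (intro sum.cong) auto

lemma bexp_sum: "bexp F p (\<lambda>A. \<Sum>i\<in>I. g i A) = (\<Sum>i\<in>I. bexp F p (g i))"
proof -
  have "bexp F p (\<lambda>A. \<Sum>i\<in>I. g i A)
      = (\<Sum>A\<in>Pow F. \<Sum>i\<in>I. p ^ card A * (1 - p) ^ card (F - A) * g i A)"
    by (simp add: bexp_def sum_distrib_left)
  also have "\<dots> = (\<Sum>i\<in>I. bexp F p (g i))"
    unfolding bexp_def by (rule sum.swap)
  finally show ?thesis .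
qed

lemma bexp_mono:
  assumes "0 \<le> p" "p \<le> 1" "\<And>A. A \<subseteq> F \<Longrightarrow> g A \<le> h A"
  shows "bexp F p g \<le> bexp F p h"
  unfolding bexp_def using assms by (intro sum_mono mult_left_mono) auto

text \<open>Conditioning on whether e is chosen, the recursion behind the product rules
  below.\<close>

lemma bexp_insert:
  assumes "finite F" "e \<notin> F"
  shows "bexp (insert e F) p g = p * bexp F p (\<lambda>A. g (insert e A)) + (1 - p) * bexp F p g"
proof -
  let ?w = "\<lambda>F A. p ^ card A * (1 - p) ^ card (F - A)"
  have inj: "inj_on (insert e) (Pow F)"
    using assms(2) by (auto simp: inj_on_def)
  have "bexp (insert e F) p g =
      (\<Sum>A\<in>Pow F. ?w (insert e F) A * g A) + (\<Sum>A\<in>insert e ` Pow F. ?w (insert e F) A * g A)"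
    unfolding bexp_def Pow_insert using assms by (intro sum.union_disjoint) auto
  also have "(\<Sum>A\<in>insert e ` Pow F. ?w (insert e F) A * g A) =
      (\<Sum>A\<in>Pow F. ?w (insert e F) (insert e A) * g (insert e A))"
    by (simp add: sum.reindex[OF inj])
  also have "\<dots> = (\<Sum>A\<in>Pow F. p * (?w F A * g (insert e A)))"
  proof (rule sum.cong)
    fix A assume "A \<in> Pow F"
    then have "e \<notin> A" "finite A" using assms by (auto intro: finite_subset)
    moreover have "insert e F - insert e A = F - A" using assms(2) by auto
    ultimately show "?w (insert e F) (insert e A) * g (insert e A) = p * (?w F A * g (insert e A))"
      by simp
  qed simp
  also have "(\<Sum>A\<in>Pow F. ?w (insert e F) A * g A) = (\<Sum>A\<in>Pow F. (1 - p) * (?w F A * g A))"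
  proof (rule sum.cong)
    fix A assume "A \<in> Pow F"
    then have "insert e F - A = insert e (F - A)" using assms(2) by auto
    then have "card (insert e F - A) = Suc (card (F - A))" using assms by simp
    then show "?w (insert e F) A * g A = (1 - p) * (?w F A * g A)" by simp
  qed simp
  finally show ?thesis by (simp add: bexp_def sum_distrib_left)
qed

lemma bexp_const [simp]: "finite F \<Longrightarrow> bexp F p (\<lambda>_. c) = c"
  by (induction F rule: finite_induct) (simp_all add: bexp_insert algebra_simps)

lemma bexp_Un:
  assumes "finite F" "finite G" "F \<inter> G = {}"
  shows "bexp (F \<union> G) p g = bexp F p (\<lambda>A. bexp G p (\<lambda>B. g (A \<union> B)))"
  using assms(1,3)
proof (induction F arbitrary: g rule: finite_induct)
  case (insert e F)
  then show ?case using assms(2) by (simp add: bexp_insert)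
qed simp

lemma bexp_restrict:
  assumes "finite F" "G \<subseteq> F"
  shows "bexp F p (\<lambda>A. h (A \<inter> G)) = bexp G p h"
proof -
  have fin: "finite (F - G)" "finite G" using assms by (auto intro: finite_subset)
  have "bexp ((F - G) \<union> G) p (\<lambda>A. h (A \<inter> G))
      = bexp (F - G) p (\<lambda>A. bexp G p (\<lambda>B. h ((A \<union> B) \<inter> G)))"
    using fin by (intro bexp_Un) auto
  also have "\<dots> = bexp (F - G) p (\<lambda>A. bexp G p h)"
  proof (intro bexp_cong arg_cong[of _ _ h])
    fix A B assume "A \<subseteq> F - G" "B \<subseteq> G"
    then show "(A \<union> B) \<inter> G = B" by auto
  qed
  also have "(F - G) \<union> G = F" using assms by auto
  finally show ?thesis using fin by simp
qed

lemma bexp_indep: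
  assumes "finite F" "G \<subseteq> F" "H \<subseteq> F" "G \<inter> H = {}"
  shows "bexp F p (\<lambda>A. g (A \<inter> G) * h (A \<inter> H)) = bexp G p g * bexp H p h"
proof -
  have fin: "finite G" "finite H" using assms by (auto intro: finite_subset)
  have "bexp F p (\<lambda>A. g (A \<inter> G) * h (A \<inter> H))
      = bexp F p (\<lambda>A. (\<lambda>C. g (C \<inter> G) * h (C \<inter> H)) (A \<inter> (G \<union> H)))"
    by (intro bexp_cong) (simp add: Int_assoc Int_absorb1 Int_absorb2)
  also have "\<dots> = bexp (G \<union> H) p (\<lambda>A. g (A \<inter> G) * h (A \<inter> H))"
    using assms by (intro bexp_restrict) auto
  also have "\<dots> = bexp G p (\<lambda>A. bexp H p (\<lambda>B. g ((A \<union> B) \<inter> G) * h ((A \<union> B) \<inter> H)))"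
    using fin assms(4) by (rule bexp_Un)
  also have "\<dots> = bexp G p (\<lambda>A. bexp H p (\<lambda>B. g A * h B))"
  proof (intro bexp_cong arg_cong2[of _ _ _ _ "(*)"] arg_cong[of _ _ g] arg_cong[of _ _ h])
    fix A B assume "A \<subseteq> G" "B \<subseteq> H"
    then show "(A \<union> B) \<inter> G = A" "(A \<union> B) \<inter> H = B" using assms(4) by auto
  qed
  also have "\<dots> = bexp G p g * bexp H p h" by (simp add: bexp_cmult bexp_multc)
  finally show ?thesis .
qed

lemma bexp_power_card:
  "finite F \<Longrightarrow> bexp F p (\<lambda>A. x ^ card A) = (1 - p + p * x) ^ card F"
proof (induction F rule: finite_induct)
  case (insert e F)
  have "bexp F p (\<lambda>A. x ^ card (insert e A)) = bexp F p (\<lambda>A. x * x ^ card A)"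
  proof (rule bexp_cong)
    fix A assume "A \<subseteq> F"
    then have "e \<notin> A" "finite A" using insert by (auto intro: finite_subset)
    then show "x ^ card (insert e A) = x * x ^ card A" by simp
  qed
  then show ?case using insert by (simp add: bexp_insert bexp_cmult algebra_simps)
qed simp

text \<open>Read off from the generating function at p = 1/2, where all subsets have equal
  weight.\<close>

lemma sum_power_card:
  "finite V \<Longrightarrow> (\<Sum>S\<in>Pow V. z ^ card S) = (1 + z :: real) ^ card V"
proof -
  assume V: "finite V"
  have "(\<Sum>S\<in>Pow V. z ^ card S) = 2 ^ card V * bexp V (1/2) (\<lambda>A. z ^ card A)"
    unfolding bexp_def sum_distrib_left
  proof (rule sum.cong)
    fix S assume "S \<in> Pow V"
    then have "card V = card S + card (V - S)"
      using V card_Int_Diff[OF V, of S] by (simp add: Int_absorb1)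
    then have "(2 :: real) ^ card V * ((1/2) ^ card S * (1/2) ^ card (V - S)) = 1"
      by (simp add: power_add power_one_over)
    then show "z ^ card S = 2 ^ card V * ((1/2) ^ card S * (1 - 1/2) ^ card (V - S) * z ^ card S)"
      by (simp add: mult.assoc[symmetric])
  qed simp
  also have "\<dots> = (2 * (1 - 1/2 + 1/2 * z)) ^ card V"
    unfolding bexp_power_card[OF V] power_mult_distrib ..
  finally show ?thesis by simp
qed

lemma bprob_cong: "(\<And>A. A \<subseteq> F \<Longrightarrow> Q A = R A) \<Longrightarrow> bprob F p Q = bprob F p R"
  unfolding bprob_def by (intro bexp_cong) auto

lemma bprob_nonneg: "0 \<le> p \<Longrightarrow> p \<le> 1 \<Longrightarrow> 0 \<le> bprob F p Q"
  unfolding bprob_def bexp_def by (intro sum_nonneg) auto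

lemma bprob_mono:
  "0 \<le> p \<Longrightarrow> p \<le> 1 \<Longrightarrow> (\<And>A. A \<subseteq> F \<Longrightarrow> Q A \<Longrightarrow> R A) \<Longrightarrow> bprob F p Q \<le> bprob F p R"
  unfolding bprob_def by (intro bexp_mono) auto

lemma bprob_compl: "finite F \<Longrightarrow> bprob F p (\<lambda>A. \<not> Q A) = 1 - bprob F p Q"
proof -
  assume "finite F"
  then have "1 = bexp F p (\<lambda>A. of_bool (\<not> Q A) + of_bool (Q A))"
    by (subst bexp_cong[of _ _ "\<lambda>_. 1"]) auto
  then show ?thesis by (simp add: bprob_def bexp_add)
qed

lemma bprob_disj:
  assumes "0 \<le> p" "p \<le> 1"
  shows "bprob F p (\<lambda>A. Q A \<or> R A) \<le> bprob F p Q + bprob F p R"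
  unfolding bprob_def bexp_add[symmetric] using assms by (intro bexp_mono) auto

lemma bprob_union_bound:
  assumes "0 \<le> p" "p \<le> 1" "finite I"
  shows "bprob F p (\<lambda>A. \<exists>i\<in>I. Q i A) \<le> (\<Sum>i\<in>I. bprob F p (Q i))"
  unfolding bprob_def bexp_sum[symmetric]
proof (rule bexp_mono[OF assms(1,2)])
  fix A show "(of_bool (\<exists>i\<in>I. Q i A) :: real) \<le> (\<Sum>i\<in>I. of_bool (Q i A))"
  proof (cases "\<exists>i\<in>I. Q i A")
    case True
    then obtain i where i: "i \<in> I" "Q i A" by blast
    have "(of_bool (Q i A) :: real) \<le> (\<Sum>i\<in>I. of_bool (Q i A))"
      using assms(3) i(1) by (intro member_le_sum) auto
    then show ?thesis using i True by simp
  qed (simp add: sum_nonneg)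
qed

text \<open>Markov's inequality for exp (l X) with X = \<open>card (A \<inter> G)\<close>, whose
  mean is (1 - p + p e^l)^|G|. Both tails are covered at once: multiplied by l, the premise on Q
  means X \<ge> a for l > 0 and X \<le> a for l < 0.\<close>

lemma chernoff_exp:
  assumes "0 \<le> p" "p \<le> 1" "finite F" "G \<subseteq> F"
    and Q: "\<And>A. Q A \<Longrightarrow> l * a \<le> l * real (card (A \<inter> G))"
  shows "bprob F p Q \<le> exp (p * real (card G) * (exp l - 1) - l * a)"
proof -
  have finG: "finite G" using assms by (auto intro: finite_subset)
  have "bprob F p Q \<le> bexp F p (\<lambda>A. exp (- l * a) * exp l ^ card (A \<inter> G))"
    unfolding bprob_def
  proof (rule bexp_mono[OF assms(1,2)])
    fix A
    have "exp (- l * a) * exp l ^ card (A \<inter> G) = exp (l * real (card (A \<inter> G)) - l * a)"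
      by (simp add: exp_of_nat_mult[symmetric] exp_add[symmetric] mult.commute)
    then show "of_bool (Q A) \<le> exp (- l * a) * exp l ^ card (A \<inter> G)" using Q[of A] by simp
  qed
  also have "\<dots> = exp (- l * a) * (1 - p + p * exp l) ^ card G"
    unfolding bexp_cmult bexp_restrict[OF assms(3,4), of p "\<lambda>A. exp l ^ card A"]
      bexp_power_card[OF finG] ..
  also have "\<dots> \<le> exp (- l * a) * exp (p * (exp l - 1)) ^ card G"
  proof (intro mult_left_mono power_mono)
    show "1 - p + p * exp l \<le> exp (p * (exp l - 1))"
      using exp_ge_add_one_self[of "p * (exp l - 1)"] by (simp add: algebra_simps)
    show "0 \<le> 1 - p + p * exp l" using assms by simp
  qed simp
  also have "\<dots> = exp (p * real (card G) * (exp l - 1) - l * a)"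
    by (simp add: exp_of_nat_mult[symmetric] exp_add[symmetric] algebra_simps)
  finally show ?thesis .
qed

section \<open>Binomial tails\<close>

definition bpm :: "nat \<Rightarrow> real \<Rightarrow> nat \<Rightarrow> real" where
  "bpm N p k = real (N choose k) * p ^ k * (1 - p) ^ (N - k)"

definition bcdf :: "nat \<Rightarrow> real \<Rightarrow> nat \<Rightarrow> real" where
  "bcdf N p k = (\<Sum>i\<le>k. bpm N p i)"

lemma bprob_card_eq:
  assumes "finite F"
  shows "bprob F p (\<lambda>A. card A = k) = bpm (card F) p k"
proof -
  have "bprob F p (\<lambda>A. card A = k) =
      (\<Sum>A\<in>{A\<in>Pow F. card A = k}. p ^ card A * (1 - p) ^ card (F - A))"
    unfolding bprob_def bexp_def using assms
    by (intro sum.mono_neutral_cong_right) auto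
  also have "\<dots> = (\<Sum>A\<in>{A\<in>Pow F. card A = k}. p ^ k * (1 - p) ^ (card F - k))"
  proof (rule sum.cong)
    fix A assume "A \<in> {A\<in>Pow F. card A = k}"
    then have "card (F - A) = card F - k" using assms by (auto simp: card_Diff_subset finite_subset)
    then show "p ^ card A * (1 - p) ^ card (F - A) = p ^ k * (1 - p) ^ (card F - k)"
      using \<open>A \<in> _\<close> by simp
  qed simp
  also have "{A\<in>Pow F. card A = k} = {A. A \<subseteq> F \<and> card A = k}" by auto
  finally show ?thesis using n_subsets[OF assms, of k] by (simp add: bpm_def)
qed

lemma bprob_card_le:
  assumes "finite F"
  shows "bprob F p (\<lambda>A. card A \<le> k) = bcdf (card F) p k"
proof -
  have "bprob F p (\<lambda>A. card A \<le> k) = bexp F p (\<lambda>A. \<Sum>i\<le>k. of_bool (card A = i))"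
    unfolding bprob_def by (intro bexp_cong) (simp add: of_bool_def)
  also have "\<dots> = bcdf (card F) p k"
    unfolding bexp_sum bcdf_def using bprob_card_eq[OF assms] by (simp add: bprob_def)
  finally show ?thesis .
qed

lemma bpm_nonneg: "0 \<le> p \<Longrightarrow> p \<le> 1 \<Longrightarrow> 0 \<le> bpm N p k"
  by (simp add: bpm_def)

lemma bcdf_nonneg: "0 \<le> p \<Longrightarrow> p \<le> 1 \<Longrightarrow> 0 \<le> bcdf N p k"
  by (simp add: bcdf_def sum_nonneg bpm_nonneg)

lemma bcdf_mono: "0 \<le> p \<Longrightarrow> p \<le> 1 \<Longrightarrow> k \<le> l \<Longrightarrow> bcdf N p k \<le> bcdf N p l"
  unfolding bcdf_def by (intro sum_mono2) (auto simp: bpm_nonneg)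

lemma bcdf_full: "bcdf N p N = 1"
  using bprob_card_le[of "{..<N}" p N] bprob_cong[of "{..<N}" "\<lambda>A. card A \<le> N" "\<lambda>_. True" p]
    card_mono[of "{..<N}"]
  by (simp add: bprob_def)

text \<open>It suffices that the last trial fails and the others give at most k successes.\<close>

lemma bcdf_Suc_ge:
  assumes "0 \<le> p" "p \<le> 1"
  shows "(1 - p) * bcdf N p k \<le> bcdf (Suc N) p k"
proof -
  have "bcdf (Suc N) p k = bprob (insert N {..<N}) p (\<lambda>A. card A \<le> k)"
    by (subst bprob_card_le) auto
  also have "\<dots> = p * bexp {..<N} p (\<lambda>A. of_bool (card (insert N A) \<le> k)) + (1 - p) * bcdf N p k"
    using bprob_card_le[of "{..<N}" p k] unfolding bprob_def by (subst bexp_insert) auto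
  finally show ?thesis
    using assms bprob_nonneg[OF assms, of "{..<N}" "\<lambda>A. card (insert N A) \<le> k"]
    by (simp add: bprob_def)
qed

text \<open>The ratio of consecutive terms is (N - k) p / ((k + 1) (1 - p)); the factor 2 absorbs 1
  / (1 - p).\<close>

lemma bpm_Suc_le:
  assumes "0 \<le> p" "p \<le> 1/2" "real N * p \<le> d"
  shows "bpm N p (Suc k) \<le> 2 * d / real (Suc k) * bpm N p k"
proof (cases "k < N")
  case False
  then have "bpm N p (Suc k) = 0" by (simp add: bpm_def binomial_eq_0)
  moreover have "0 \<le> d" using assms mult_nonneg_nonneg[of "real N" p] by linarith
  ultimately show ?thesis using assms bpm_nonneg[of p N k] by simp
next
  case True
  let ?B = "p ^ k * (1 - p) ^ (N - Suc k)"
  have NS: "N - k = Suc (N - Suc k)" using True by simp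
  have "real (Suc k) * real (N choose Suc k) = real (N - k) * real (N choose k)"
    using binomial_absorb_comp[of N k] Suc_times_binomial_add[of k "N - Suc k"] True NS
    by (metis (no_types, lifting) binomial_absorption of_nat_mult binomial_absorb_comp Suc_times_binomial_eq mult.commute)
  then have c: "real (N choose Suc k) = real (N - k) * real (N choose k) / real (Suc k)"
    by (simp add: field_simps)
  have "(1 - p) * bpm N p (Suc k) = p * real (N - k) / real (Suc k) * bpm N p k"
    unfolding bpm_def c NS by (simp add: field_simps)
  moreover have "p * real (N - k) / real (Suc k) * bpm N p k \<le> d / real (Suc k) * bpm N p k"
  proof (intro mult_right_mono divide_right_mono)
    have "p * real (N - k) \<le> p * real N" using assms by (intro mult_left_mono) auto
    then show "p * real (N - k) \<le> d" using assms by (simp add: mult.commute)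
  qed (use assms bpm_nonneg in auto)
  moreover have "1/2 * bpm N p (Suc k) \<le> (1 - p) * bpm N p (Suc k)"
    using assms bpm_nonneg[of p N "Suc k"] by (intro mult_right_mono) auto
  ultimately have "1/2 * bpm N p (Suc k) \<le> d / real (Suc k) * bpm N p k" by linarith
  then show ?thesis by (simp add: mult_ac)
qed

lemma bpm_add_le:
  assumes "0 \<le> p" "p \<le> 1/2" "real N * p \<le> d"
  shows "bpm N p (k + i) \<le> bpm N p k * ((2 * d) ^ i / fact i)"
proof (induction i)
  case (Suc i)
  have d: "0 \<le> d" using assms mult_nonneg_nonneg[of "real N" p] by linarith
  have "bpm N p (k + Suc i) \<le> 2 * d / real (Suc (k + i)) * bpm N p (k + i)"
    using bpm_Suc_le[OF assms, of "k + i"] by simp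
  also have "\<dots> \<le> 2 * d / real (Suc i) * (bpm N p k * ((2 * d) ^ i / fact i))"
    using Suc d bpm_nonneg[of p N] assms by (intro mult_mono divide_left_mono) auto
  finally show ?case by (simp add: field_simps)
qed simp

text \<open>Rankin's trick: each term is multiplied by x^(i - j) \<ge> 1, and the sum is then
  completed to the exponential series.\<close>

lemma sum_exp_terms_le:
  fixes x y :: real
  assumes "0 < x" "x \<le> 1" "0 \<le> y"
  shows "(\<Sum>i\<le>j. y ^ i / fact i) \<le> exp (y * x) / x ^ j"
proof -
  have "(\<Sum>i\<le>j. y ^ i / fact i) \<le> (\<Sum>i\<le>j. (y * x) ^ i / fact i / x ^ j)"
  proof (rule sum_mono)
    fix i assume "i \<in> {..j}"
    then have "x ^ j \<le> x ^ i" using assms by (intro power_decreasing) auto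
    then have "y ^ i / fact i * x ^ j \<le> y ^ i / fact i * x ^ i"
      using assms by (intro mult_left_mono) auto
    then show "y ^ i / fact i \<le> (y * x) ^ i / fact i / x ^ j"
      using assms by (simp add: field_simps)
  qed
  also have "\<dots> = (\<Sum>i\<le>j. (y * x) ^ i / fact i) / x ^ j" by (simp add: sum_divide_distrib)
  also have "(\<Sum>i\<le>j. (y * x) ^ i / fact i) \<le> exp (y * x)"
  proof -
    have "(\<Sum>i\<le>j. (y * x) ^ i /\<^sub>R fact i) \<le> (\<Sum>i. (y * x) ^ i /\<^sub>R fact i)"
      using assms by (intro sum_le_suminf summable_exp_generic) auto
    then show ?thesis by (simp add: exp_def divide_inverse mult.commute)
  qed
  finally show ?thesis using assms by (simp add: divide_right_mono)
qed

text \<open>The i-th new term is at most \<open>bpm N p k\<close> times (2 d)^i / i!, and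
  \<open>bpm N p k\<close> is at most \<open>bcdf N p k\<close>. The parameter x is free: with a
  small constant x, raising the level by a sufficiently small multiple of d costs little more than a
  small power of e^d.\<close>

lemma bcdf_add_le:
  assumes "0 \<le> p" "p \<le> 1/2" "real N * p \<le> d" "0 < x" "x \<le> 1"
  shows "bcdf N p (k + j) \<le> bcdf N p k * (exp (2 * d * x) / x ^ j)"
proof -
  have d: "0 \<le> d" using assms mult_nonneg_nonneg[of "real N" p] by linarith
  have le: "bpm N p k \<le> bcdf N p k"
    unfolding bcdf_def using assms by (intro member_le_sum) (auto simp: bpm_nonneg)
  have "bcdf N p (k + j) \<le> bcdf N p k * (\<Sum>i\<le>j. (2 * d) ^ i / fact i)"
  proof (induction j)
    case (Suc j)
    have "bpm N p (k + Suc j) \<le> bcdf N p k * ((2 * d) ^ Suc j / fact (Suc j))"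
      using bpm_add_le[OF assms(1-3), of k "Suc j"] le d
      by (meson divide_nonneg_nonneg fact_ge_zero mult_right_mono order_trans zero_le_mult_iff zero_le_numeral zero_le_power)
    moreover have "bcdf N p (k + Suc j) = bcdf N p (k + j) + bpm N p (k + Suc j)"
      by (simp add: bcdf_def)
    ultimately show ?case using Suc unfolding sum.atMost_Suc distrib_left by linarith
  qed simp
  also have "\<dots> \<le> bcdf N p k * (exp (2 * d * x) / x ^ j)"
    using assms d by (intro mult_left_mono sum_exp_terms_le bcdf_nonneg) auto
  finally show ?thesis .
qed

section \<open>Random graphs: Chernoff bounds\<close>

lemma prob_Gnp_eq_bprob: "prob_Gnp n p Q = bprob (all_edges n) p Q"
proof -
  have "prob_Gnp n p Q = (\<Sum>E\<in>Pow (all_edges n).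
      p ^ card E * (1 - p) ^ card (all_edges n - E) * of_bool (Q E))"
    unfolding prob_Gnp_def
    by (rule sum.mono_neutral_cong_left)
      (auto simp: card_Diff_subset finite_subset[OF _ finite_all_edges])
  then show ?thesis by (simp add: bprob_def bexp_def)
qed

lemma all_edgesE:
  assumes "e \<in> all_edges n"
  obtains x y where "e = {x, y}" "x \<noteq> y" "x \<in> {1..n}" "y \<in> {1..n}"
  using assms unfolding all_edges_def by blast

lemma sum_degrees:
  assumes "E \<subseteq> all_edges n" "finite R"
  shows "(\<Sum>v\<in>R. degree E v) = card (boundary E R) + 2 * card (inner_edges E R)"
proof -
  have fin: "finite E" using assms(1) finite_all_edges by (rule finite_subset)
  have "(\<Sum>v\<in>R. degree E v) = (\<Sum>v\<in>R. \<Sum>e\<in>E. if v \<in> e then 1 else 0)"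
    using fin by (simp add: degree_eq_card_incident[OF assms(1)] sum.If_cases Int_def)
  also have "\<dots> = (\<Sum>e\<in>E. \<Sum>v\<in>R. if v \<in> e then 1 else 0)" by (rule sum.swap)
  also have "\<dots> = (\<Sum>e\<in>E. card (R \<inter> e))"
    using assms(2) by (simp add: sum.If_cases Int_def)
  also have "\<dots> = (\<Sum>e\<in>E. (if e \<in> boundary E R then 1 else 0) + (if e \<in> inner_edges E R then 2 else 0))"
  proof (rule sum.cong)
    fix e assume e: "e \<in> E"
    then obtain x y where xy: "e = {x, y}" "x \<noteq> y"
      using assms(1) unfolding all_edges_def by blast
    show "card (R \<inter> e) = (if e \<in> boundary E R then 1 else 0) + (if e \<in> inner_edges E R then 2 else 0)"
      using e xy by (cases "x \<in> R"; cases "y \<in> R") (auto simp: boundary_def inner_edges_def)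
  qed simp
  also have "\<dots> = card (boundary E R) + 2 * card (inner_edges E R)"
  proof -
    have "E \<inter> {e. e \<in> boundary E R} = boundary E R" "E \<inter> {e. e \<in> inner_edges E R} = inner_edges E R"
      by (auto simp: boundary_def inner_edges_def)
    then show ?thesis using fin by (simp add: sum.distrib sum.If_cases)
  qed
  finally show ?thesis .
qed

definition star :: "nat \<Rightarrow> nat \<Rightarrow> nat set set" where
  "star n v = {e \<in> all_edges n. v \<in> e}"

lemma finite_star [simp]: "finite (star n v)"
  by (simp add: star_def)

lemma degree_eq_card_star:
  assumes "E \<subseteq> all_edges n"
  shows "degree E v = card (E \<inter> star n v)"
proof -
  have "{e \<in> E. v \<in> e} = E \<inter> star n v" using assms by (auto simp: star_def)
  then show ?thesis by (simp add: degree_eq_card_incident[OF assms])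
qed

lemma card_star:
  assumes "v \<in> {1..n}"
  shows "card (star n v) = n - 1"
proof -
  have "card (star n v) = degree (all_edges n) v"
    by (subst degree_eq_card_star[of _ n]) (auto simp: star_def intro: arg_cong[of _ _ card])
  also have "{u. {u, v} \<in> all_edges n \<and> u \<noteq> v} = {1..n} - {v}"
    unfolding all_edges_iff using assms by auto
  then have "degree (all_edges n) v = n - 1" using assms by (simp add: degree_def)
  finally show ?thesis .
qed

lemma inner_edges_Int: "E \<subseteq> all_edges n \<Longrightarrow> inner_edges E S = E \<inter> inner_edges (all_edges n) S"
  by (auto simp: inner_edges_def)

lemma boundary_Int: "E \<subseteq> all_edges n \<Longrightarrow> boundary E S = E \<inter> boundary (all_edges n) S"
  by (auto simp: boundary_def)

lemma card_inner_all_edges: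
  assumes "S \<subseteq> {1..n}"
  shows "real (card (inner_edges (all_edges n) S)) = real (card S) * (real (card S) - 1) / 2"
proof -
  have "finite S" using assms by (rule finite_subset) simp
  have "inner_edges (all_edges n) S = {e. e \<subseteq> S \<and> card e = 2}"
    unfolding inner_edges_def all_edges_iff using assms by blast
  then have "card (inner_edges (all_edges n) S) = card S * (card S - 1) div 2"
    using n_subsets[OF \<open>finite S\<close>, of 2] by (simp add: choose_two)
  moreover have "2 dvd card S * (card S - 1)" by (cases "card S") auto
  ultimately have "real (card (inner_edges (all_edges n) S)) = real (card S * (card S - 1)) / 2"
    by (simp only: real_of_nat_div of_nat_numeral)
  then show ?thesis by (cases "card S") (auto simp: field_simps)
qed

lemma inner_all_edges_UNIV: "inner_edges (all_edges n) {1..n} = all_edges n"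
  unfolding inner_edges_def using all_edges_iff by blast

lemma card_boundary_all_edges:
  assumes "R \<subseteq> {1..n}"
  shows "real (card (boundary (all_edges n) R)) = real (card R) * (real n - real (card R))"
proof -
  have fin: "finite R" using assms by (rule finite_subset) simp
  have "(\<Sum>v\<in>R. degree (all_edges n) v) = (\<Sum>v\<in>R. n - 1)"
  proof (rule sum.cong)
    fix v assume "v \<in> R"
    have "all_edges n \<inter> star n v = star n v" by (auto simp: star_def)
    then show "degree (all_edges n) v = n - 1"
      using \<open>v \<in> R\<close> assms card_star[of v n] degree_eq_card_star[of "all_edges n" n v] by auto
  qed simp
  then have eq: "card (boundary (all_edges n) R) + 2 * card (inner_edges (all_edges n) R) = card R * (n - 1)"
    using sum_degrees[of "all_edges n" n R] fin by simp
  show ?thesis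
  proof (cases "R = {}")
    case True
    then show ?thesis by (simp add: boundary_def)
  next
    case False
    then have "n \<ge> 1" using assms by auto
    then have "real (card (boundary (all_edges n) R)) + 2 * real (card (inner_edges (all_edges n) R))
        = real (card R) * (real n - 1)"
      using arg_cong[OF eq, of real] by (simp add: of_nat_diff)
    then show ?thesis unfolding card_inner_all_edges[OF assms] by (simp add: field_simps)
  qed
qed

lemma exp_minus_le: "0 \<le> x \<Longrightarrow> exp (- x) \<le> 1 / (1 + x + x\<^sup>2 / 2)" for x :: real
proof -
  assume x: "0 \<le> x"
  have "1 + x + x\<^sup>2 / 2 \<le> exp x" using x by (rule exp_lower_Taylor_quadratic)
  moreover have "0 < 1 + x + x\<^sup>2 / 2" using x by (simp add: add_pos_nonneg)
  ultimately have "1 / exp x \<le> 1 / (1 + x + x\<^sup>2 / 2)" by (intro divide_left_mono) auto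
  then show ?thesis by (simp add: exp_minus inverse_eq_divide)
qed

context
  fixes n :: nat and p d :: real
  assumes p: "0 \<le> p" "p \<le> 1" and d_def: "d = real n * p"
begin

lemma d_nonneg: "0 \<le> d"
  using p by (simp add: d_def)

text \<open>Since s \<le> 3n/4, the mean is at most 0.375 d (s - 1). The choice l = 0.1 leaves the
  exponent (0.375 * 0.11 - 0.1 * 0.475) d (s - 1) = - d (s - 1) / 160, and s - 1 \<ge> s / 2 turns
  160 into 320.\<close>

lemma prob_inner_dense:
  assumes S: "S \<subseteq> {1..n}" "2 \<le> card S" "4 * card S \<le> 3 * n"
  shows "bprob (all_edges n) p (\<lambda>E. 0.475 * d * (real (card S) - 1) \<le> real (card (inner_edges E S)))
    \<le> exp (- d * real (card S) / 320)"
proof -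
  let ?s = "real (card S)"
  have "bprob (all_edges n) p (\<lambda>E. 0.475 * d * (?s - 1) \<le> real (card (inner_edges E S))) =
      bprob (all_edges n) p (\<lambda>E. 0.475 * d * (?s - 1) \<le> real (card (E \<inter> inner_edges (all_edges n) S)))"
    by (intro bprob_cong) (simp add: inner_edges_Int)
  also have "\<dots> \<le> exp (p * real (card (inner_edges (all_edges n) S)) * (exp 0.1 - 1) - 0.1 * (0.475 * d * (?s - 1)))"
    using p by (intro chernoff_exp) (auto simp: inner_edges_def)
  also have "p * real (card (inner_edges (all_edges n) S)) * (exp 0.1 - 1) \<le>
      p * real (card (inner_edges (all_edges n) S)) * 0.11"
    using exp_bound[of "0.1"] p by (intro mult_left_mono) (auto simp: power2_eq_square)
  also have "p * real (card (inner_edges (all_edges n) S)) * 0.11 \<le> d * (?s - 1) * 0.04125"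
  proof -
    have "p * (?s - 1) * ?s \<le> p * (?s - 1) * (0.75 * real n)"
      using p S by (intro mult_left_mono mult_nonneg_nonneg) auto
    then show ?thesis unfolding card_inner_all_edges[OF S(1)] d_def by (simp add: field_simps)
  qed
  also have "d * (?s - 1) * 0.04125 - 0.1 * (0.475 * d * (?s - 1)) \<le> - d * ?s / 320"
  proof -
    have "d * (?s / 2) \<le> d * (?s - 1)" using S d_nonneg by (intro mult_left_mono) auto
    then show ?thesis by (simp add: field_simps)
  qed
  finally show ?thesis by simp
qed

text \<open>The mean is at least 0.75 d r. With l = -0.3 the exponent is at most (-0.19125 + 0.1575)
  d r, which is rounded to the rate 1/320 of the previous lemma so that both enter the same kind of
  union bound.\<close>

lemma prob_boundary_sparse:
  assumes R: "R \<subseteq> {1..n}" "4 * card R \<le> n"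
  shows "bprob (all_edges n) p (\<lambda>E. real (card (boundary E R)) \<le> 0.525 * d * real (card R))
    \<le> exp (- d * real (card R) / 320)"
proof -
  let ?r = "real (card R)"
  have "bprob (all_edges n) p (\<lambda>E. real (card (boundary E R)) \<le> 0.525 * d * ?r) =
      bprob (all_edges n) p (\<lambda>E. real (card (E \<inter> boundary (all_edges n) R)) \<le> 0.525 * d * ?r)"
    by (intro bprob_cong) (simp add: boundary_Int)
  also have "\<dots> \<le> exp (p * real (card (boundary (all_edges n) R)) * (exp (- 0.3) - 1) - (- 0.3) * (0.525 * d * ?r))"
    using p by (intro chernoff_exp) (auto simp: boundary_def)
  also have "p * real (card (boundary (all_edges n) R)) * (exp (- 0.3) - 1) \<le>
      p * real (card (boundary (all_edges n) R)) * (- 0.255)"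
    using exp_minus_le[of "0.3"] p by (intro mult_left_mono) (auto simp: power2_eq_square)
  also have "p * real (card (boundary (all_edges n) R)) * (- 0.255) \<le> d * ?r * (- 0.19125)"
  proof -
    have "p * ?r * (0.75 * real n) \<le> p * ?r * (real n - ?r)"
      using p R by (intro mult_left_mono mult_nonneg_nonneg) auto
    then show ?thesis unfolding card_boundary_all_edges[OF R(1)] d_def by (simp add: algebra_simps)
  qed
  also have "d * ?r * (- 0.19125) - (- 0.3) * (0.525 * d * ?r) \<le> - d * ?r / 320"
    using mult_nonneg_nonneg[OF d_nonneg, of ?r] by (simp add: algebra_simps)
  finally show ?thesis by simp
qed

text \<open>The mean is d (n - 1) / 2, so this is a deviation by five percent. The rate comes from
  the upper tail: 0.0416 / 2 - 0.04 * 0.525 = -1/5000.\<close>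

lemma prob_edge_count:
  assumes n: "n \<ge> 1"
  shows "bprob (all_edges n) p (\<lambda>E. real (card E) \<le> 0.475 * d * (real n - 1) \<or> 0.525 * d * (real n - 1) \<le> real (card E))
    \<le> 2 * exp (- d * (real n - 1) / 5000)"
proof -
  let ?F = "all_edges n" and ?x = "d * (real n - 1)"
  have x: "0 \<le> ?x" using n d_nonneg by simp
  have cF: "p * real (card ?F) = ?x / 2"
    using card_inner_all_edges[of "{1..n}" n] unfolding inner_all_edges_UNIV d_def by simp
  have I: "A \<inter> ?F = A" if "A \<subseteq> ?F" for A using that by auto
  have "bprob ?F p (\<lambda>E. real (card E) \<le> 0.475 * d * (real n - 1)) =
      bprob ?F p (\<lambda>E. real (card (E \<inter> ?F)) \<le> 0.475 * ?x)"
    by (intro bprob_cong) (simp add: I mult.assoc)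
  also have "\<dots> \<le> exp (p * real (card ?F) * (exp (- 0.05) - 1) - (- 0.05) * (0.475 * ?x))"
    using p by (intro chernoff_exp) auto
  also have "\<dots> \<le> exp (- ?x / 5000)"
  proof -
    have "?x / 2 * (exp (- 0.05) - 1) \<le> ?x / 2 * (- 0.0485)"
      using exp_minus_le[of "0.05"] x by (intro mult_left_mono) (auto simp: power2_eq_square)
    then show ?thesis unfolding cF using x by simp
  qed
  finally have 1: "bprob ?F p (\<lambda>E. real (card E) \<le> 0.475 * d * (real n - 1)) \<le> exp (- ?x / 5000)" .
  have "bprob ?F p (\<lambda>E. 0.525 * d * (real n - 1) \<le> real (card E)) =
      bprob ?F p (\<lambda>E. 0.525 * ?x \<le> real (card (E \<inter> ?F)))"
    by (intro bprob_cong) (simp add: I mult.assoc)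
  also have "\<dots> \<le> exp (p * real (card ?F) * (exp 0.04 - 1) - 0.04 * (0.525 * ?x))"
    using p by (intro chernoff_exp) auto
  also have "\<dots> \<le> exp (- ?x / 5000)"
  proof -
    have "?x / 2 * (exp 0.04 - 1) \<le> ?x / 2 * 0.0416"
      using exp_bound[of "0.04"] x by (intro mult_left_mono) (auto simp: power2_eq_square)
    then show ?thesis unfolding cF using x by simp
  qed
  finally have 2: "bprob ?F p (\<lambda>E. 0.525 * d * (real n - 1) \<le> real (card E)) \<le> exp (- ?x / 5000)" .
  show ?thesis
    by (rule order_trans[OF bprob_disj[OF p]]) (use 1 2 in simp)
qed

text \<open>The tilt l = ln X grows as the sets shrink: the factor X that it costs is paid by the
  small mean, as p s^2 / 2 * X \<le> d s / 2. Hence even a tiny density c is out of reach for sets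
  of size at most n / X once c ln X is large.\<close>

lemma prob_small_dense:
  assumes S: "S \<subseteq> {1..n}" and X: "X \<ge> 1" "X * real (card S) \<le> real n"
  shows "bprob (all_edges n) p (\<lambda>E. c * d * real (card S) \<le> real (card (inner_edges E S)))
    \<le> exp (d * real (card S) * (1/2 - c * ln X))"
proof -
  let ?s = "real (card S)"
  have "bprob (all_edges n) p (\<lambda>E. c * d * ?s \<le> real (card (inner_edges E S))) =
      bprob (all_edges n) p (\<lambda>E. c * d * ?s \<le> real (card (E \<inter> inner_edges (all_edges n) S)))"
    by (intro bprob_cong) (simp add: inner_edges_Int)
  also have "\<dots> \<le> exp (p * real (card (inner_edges (all_edges n) S)) * (exp (ln X) - 1) - ln X * (c * d * ?s))"
    using p X by (intro chernoff_exp) (auto simp: inner_edges_def intro!: mult_left_mono)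
  also have "p * real (card (inner_edges (all_edges n) S)) * (exp (ln X) - 1) \<le> d * ?s / 2"
  proof -
    have "real (card (inner_edges (all_edges n) S)) \<le> ?s * ?s / 2"
      unfolding card_inner_all_edges[OF S] by (intro divide_right_mono mult_left_mono) auto
    then have "p * real (card (inner_edges (all_edges n) S)) * (exp (ln X) - 1) \<le> p * (?s * ?s / 2) * X"
      using X p by (intro mult_mono mult_left_mono) auto
    also have "\<dots> = p * ?s / 2 * (X * ?s)" by simp
    also have "\<dots> \<le> p * ?s / 2 * real n" using X p by (intro mult_left_mono) auto
    finally show ?thesis by (simp add: d_def mult_ac)
  qed
  also have "d * ?s / 2 - ln X * (c * d * ?s) = d * ?s * (1/2 - c * ln X)" by (simp add: algebra_simps)
  finally show ?thesis by simp
qed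

end

section \<open>Sufficient conditions for the packing formula\<close>

text \<open>D separates e(S) / (|S| - 1) from m / (n - 1). Singletons, for which the first quotient
  makes no sense, span no edges.\<close>

lemma packing_eq_if_dense:
  fixes n :: nat and D :: real
  defines "V \<equiv> {1..n}"
  assumes n: "n \<ge> 2" and E: "E \<subseteq> all_edges n"
    and T: "T = min (min_degree n E) (card E div (n - 1))"
    and m: "D * (real n - 1) \<le> real (card E)"
    and inner: "\<And>S. T > 0 \<Longrightarrow> S \<subseteq> V \<Longrightarrow> 2 \<le> card S \<Longrightarrow> 4 * card S \<le> 3 * n \<Longrightarrow>
      real (card (inner_edges E S)) \<le> D * (real (card S) - 1)"
    and boundary: "\<And>R. T > 0 \<Longrightarrow> R \<subseteq> V \<Longrightarrow> R \<noteq> {} \<Longrightarrow> 4 * card R < n \<Longrightarrow>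
      T * card R \<le> card (boundary E R)"
  shows "tree_packing n E = T"
proof (rule tree_packing_eqI[OF n E T])
  fix S assume T0: "T > 0" and S: "S \<subseteq> {1..n}" "S \<noteq> {}" "4 * card S \<le> 3 * n"
  have fin: "finite S" using S(1) by (rule finite_subset) simp
  show "(n - 1) * card (inner_edges E S) \<le> (card S - 1) * card E"
  proof (cases "card S = 1")
    case True
    have "e \<notin> inner_edges E S" for e
      using E all_edges_iff[of e n] card_mono[OF fin, of e] True unfolding inner_edges_def by auto
    then have "inner_edges E S = {}" by blast
    then show ?thesis by simp
  next
    case False
    then have s: "2 \<le> card S" using S(2) fin card_gt_0_iff[of S] by linarith
    have "(real n - 1) * real (card (inner_edges E S)) \<le> (real n - 1) * (D * (real (card S) - 1))"
      using inner[OF T0 _ s S(3)] S(1) n by (intro mult_left_mono) (auto simp: V_def)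
    also have "\<dots> = (real (card S) - 1) * (D * (real n - 1))" by simp
    also have "\<dots> \<le> (real (card S) - 1) * real (card E)" using m s by (intro mult_left_mono) auto
    finally have "real ((n - 1) * card (inner_edges E S)) \<le> real ((card S - 1) * card E)"
      using n s by (simp add: of_nat_diff)
    then show ?thesis by (simp only: of_nat_le_iff)
  qed
qed (use boundary in \<open>auto simp: V_def\<close>)

text \<open>An edge inside R that is not inside R - L joins a vertex of R - L to its only neighbour in L,
  so R spans few edges compared with the surplus h of its vertices outside L.\<close>

lemma light_cut:
  fixes c h :: real
  assumes E: "E \<subseteq> all_edges n" and R: "R \<subseteq> {1..n}"
    and T: "\<And>v. v \<in> R \<Longrightarrow> T \<le> degree E v"
    and heavy: "\<And>v. v \<in> R - L \<Longrightarrow> real T + h \<le> real (degree E v)"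
    and adj: "\<And>u v. u \<in> L \<inter> {1..n} \<Longrightarrow> v \<in> L \<inter> {1..n} \<Longrightarrow> u \<noteq> v \<Longrightarrow> {u, v} \<notin> E"
    and nbr: "\<And>u v w. u \<in> L \<inter> {1..n} \<Longrightarrow> v \<in> L \<inter> {1..n} \<Longrightarrow> u \<noteq> v \<Longrightarrow> w \<notin> {u, v} \<Longrightarrow> {u, w} \<in> E \<Longrightarrow> {v, w} \<notin> E"
    and inner: "real (card (inner_edges E (R - L))) \<le> c * real (card (R - L))"
    and h: "2 * c + 2 \<le> h"
  shows "T * card R \<le> card (boundary E R)"
proof -
  let ?H = "R - L"
  have fin: "finite R" using R by (rule finite_subset) simp
  have finE: "finite E" using E finite_all_edges by (rule finite_subset)
  have "inner_edges E R \<subseteq> inner_edges E ?H \<union> (\<Union>w\<in>?H. {e \<in> E. \<exists>u \<in> L \<inter> {1..n}. u \<noteq> w \<and> e = {u, w}})"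
  proof
    fix e assume e: "e \<in> inner_edges E R"
    then have eE: "e \<in> E" and eR: "e \<subseteq> R" by (auto simp: inner_edges_def)
    then obtain x y where "e = {x, y}" "x \<noteq> y" "x \<in> {1..n}" "y \<in> {1..n}"
      using E all_edgesE[of e n] by blast
    with eE eR have xy: "e = {x, y}" "x \<noteq> y" "x \<in> R" "y \<in> R" "e \<in> E" "x \<in> {1..n}" "y \<in> {1..n}"
      by auto
    have "\<not> (x \<in> L \<and> y \<in> L)" using adj xy by blast
    then consider "x \<notin> L" "y \<notin> L" | "x \<in> L" "y \<notin> L" | "x \<notin> L" "y \<in> L" by blast
    then show "e \<in> inner_edges E ?H \<union> (\<Union>w\<in>?H. {e \<in> E. \<exists>u \<in> L \<inter> {1..n}. u \<noteq> w \<and> e = {u, w}})"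
    proof cases
      case 1
      then show ?thesis using xy by (simp add: inner_edges_def)
    next
      case 2
      then have "e \<in> {e \<in> E. \<exists>u \<in> L \<inter> {1..n}. u \<noteq> y \<and> e = {u, y}}" "y \<in> ?H" using xy by blast+
      then show ?thesis by blast
    next
      case 3
      have "e = {y, x}" using xy(1) by (rule trans) (rule insert_commute)
      moreover have "y \<in> L \<inter> {1..n}" "y \<noteq> x" "x \<in> ?H" using 3 xy(2-7) by simp_all
      ultimately have "e \<in> {e \<in> E. \<exists>u \<in> L \<inter> {1..n}. u \<noteq> x \<and> e = {u, x}}" "x \<in> ?H"
        using eE by blast+
      then show ?thesis by blast
    qed
  qed
  then have "card (inner_edges E R) \<le>
      card (inner_edges E ?H \<union> (\<Union>w\<in>?H. {e \<in> E. \<exists>u \<in> L \<inter> {1..n}. u \<noteq> w \<and> e = {u, w}}))"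
    using finE fin by (intro card_mono) (auto simp: inner_edges_def)
  also have "\<dots> \<le> card (inner_edges E ?H) + card (\<Union>w\<in>?H. {e \<in> E. \<exists>u \<in> L \<inter> {1..n}. u \<noteq> w \<and> e = {u, w}})"
    by (rule card_Un_le)
  also have "card (\<Union>w\<in>?H. {e \<in> E. \<exists>u \<in> L \<inter> {1..n}. u \<noteq> w \<and> e = {u, w}}) \<le>
      (\<Sum>w\<in>?H. card {e \<in> E. \<exists>u \<in> L \<inter> {1..n}. u \<noteq> w \<and> e = {u, w}})"
    using fin by (intro card_UN_le) auto
  also have "\<dots> \<le> (\<Sum>w\<in>?H. 1)"
  proof (rule sum_mono)
    fix w assume "w \<in> ?H"
    let ?A = "{e \<in> E. \<exists>u \<in> L \<inter> {1..n}. u \<noteq> w \<and> e = {u, w}}"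
    have "e = f" if ef: "e \<in> ?A" "f \<in> ?A" for e f
    proof -
      obtain u v where uv: "u \<in> L \<inter> {1..n}" "u \<noteq> w" "e = {u, w}" "e \<in> E"
        "v \<in> L \<inter> {1..n}" "v \<noteq> w" "f = {v, w}" "f \<in> E" using ef by blast
      then show ?thesis using nbr[of u v w] by blast
    qed
    then have "card ?A \<le> Suc 0" using finE by (subst card_le_Suc0_iff_eq) auto
    then show "card ?A \<le> 1" by simp
  qed
  finally have "card (inner_edges E R) \<le> card (inner_edges E ?H) + card ?H" by simp
  then have i: "real (card (inner_edges E R)) \<le> (c + 1) * real (card ?H)"
    using inner by (simp add: algebra_simps)
  \<comment> \<open>The degree sum over R counts inner edges twice; this costs at most 2 (c + 1) |H|
    \<le> h |H|, which the surplus of H pays.\<close>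
  have "real T * real (card R) + h * real (card ?H) = (\<Sum>v\<in>R. real T + (if v \<in> ?H then h else 0))"
    using fin by (simp add: sum.distrib sum.If_cases mult.commute set_diff_eq Int_def)
  also have "\<dots> \<le> (\<Sum>v\<in>R. real (degree E v))"
    using T heavy by (intro sum_mono) auto
  also have "\<dots> = real (card (boundary E R)) + 2 * real (card (inner_edges E R))"
    using arg_cong[OF sum_degrees[OF E fin], of real] by simp
  also have "\<dots> \<le> real (card (boundary E R)) + 2 * ((c + 1) * real (card ?H))" using i by simp
  also have "2 * ((c + 1) * real (card ?H)) \<le> h * real (card ?H)"
    using mult_right_mono[OF h, of "real (card ?H)"] by (simp add: algebra_simps)
  finally have "real (T * card R) \<le> real (card (boundary E R))" by simp
  then show ?thesis by (simp only: of_nat_le_iff)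
qed

section \<open>Random graphs: vertices of low degree\<close>

text \<open>Stated through the star, a fixed set of potential edges, so that the restriction and
  independence rules for \<open>bexp\<close> apply.\<close>

definition low :: "nat \<Rightarrow> nat \<Rightarrow> nat \<Rightarrow> nat set set \<Rightarrow> bool" where
  "low n k v E \<longleftrightarrow> card (E \<inter> star n v) \<le> k"

context
  fixes n k :: nat and p :: real
  assumes p: "0 \<le> p" "p \<le> 1"
begin

lemma prob_low:
  assumes "v \<in> {1..n}"
  shows "bprob (all_edges n) p (low n k v) = bcdf (n - 1) p k"
proof -
  have "bprob (all_edges n) p (low n k v) = bprob (star n v) p (\<lambda>A. card A \<le> k)"
    unfolding bprob_def low_def
    by (rule bexp_restrict[where h = "\<lambda>A. of_bool (card A \<le> k)"]) (auto simp: star_def)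
  then show ?thesis using assms by (simp add: bprob_card_le card_star)
qed

lemma star_Int:
  assumes "u \<noteq> v"
  shows "star n u \<inter> star n v \<subseteq> {{u, v}}"
proof
  fix e assume "e \<in> star n u \<inter> star n v"
  then have e: "e \<in> all_edges n" "u \<in> e" "v \<in> e" by (auto simp: star_def)
  from e(1) obtain x y where "e = {x, y}" by (rule all_edgesE)
  with e assms show "e \<in> {{u, v}}" by auto
qed

lemma pair_in_star:
  "u \<in> {1..n} \<Longrightarrow> v \<in> {1..n} \<Longrightarrow> u \<noteq> v \<Longrightarrow> {u, v} \<in> star n u \<and> {u, v} \<in> star n v"
  unfolding star_def all_edges_def by blast

text \<open>The probability of at most k edges at a vertex, given that one specified edge there is present.\<close>

definition shifted :: real where
  "shifted = (if k = 0 then 0 else bcdf (n - 2) p (k - 1))"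

lemma shifted_bounds: "0 \<le> shifted" "shifted \<le> bcdf (n - 2) p k"
  using p by (auto simp: shifted_def bcdf_nonneg bcdf_mono)

lemma prob_shifted:
  "finite S \<Longrightarrow> card S = n - 2 \<Longrightarrow> bprob S p (\<lambda>A. Suc (card A) \<le> k) = shifted"
proof (cases "k = 0")
  case False
  assume S: "finite S" "card S = n - 2"
  have "Suc c \<le> k \<longleftrightarrow> c \<le> k - 1" for c using False by auto
  then show ?thesis using S False bprob_card_le[of S p "k - 1"] by (simp add: shifted_def)
next
  case True
  then show ?thesis unfolding shifted_def by (simp add: bprob_def bexp_def)
qed

text \<open>The stars of u and v share only the edge {u, v}; once its presence is fixed, the two
  events depend on disjoint edge sets.\<close>

lemma prob_low_pair:
  assumes u: "u \<in> {1..n}" and v: "v \<in> {1..n}" and uv: "u \<noteq> v"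
  shows "bexp (all_edges n) p (\<lambda>E. of_bool (low n k u E) * of_bool (low n k v E))
      = p * shifted\<^sup>2 + (1 - p) * (bcdf (n - 2) p k)\<^sup>2" (is ?pair)
    and "bcdf (n - 1) p k = p * shifted + (1 - p) * bcdf (n - 2) p k" (is ?single)
proof -
  let ?e = "{u, v}" and ?F = "all_edges n - {{u, v}}"
  let ?S = "\<lambda>x. star n x - {{u, v}}"
  have e: "?e \<in> star n u" "?e \<in> star n v" using pair_in_star[OF u v uv] by auto
  then have F: "all_edges n = insert ?e ?F" by (auto simp: star_def)
  have cS: "card (?S u) = n - 2" "card (?S v) = n - 2"
    using e card_star[OF u] card_star[OF v] by simp_all
  have SF: "?S u \<subseteq> ?F" "?S v \<subseteq> ?F" by (auto simp: star_def)
  have dis: "?S u \<inter> ?S v = {}" using star_Int[OF uv] by auto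
  have out: "A \<inter> star n x = A \<inter> ?S x" if "A \<subseteq> ?F" for A x using that by auto
  have inn: "card (insert ?e A \<inter> star n x) = Suc (card (A \<inter> ?S x))" if "A \<subseteq> ?F" "?e \<in> star n x" for A x
  proof -
    have "insert ?e A \<inter> star n x = insert ?e (A \<inter> ?S x)" using that by auto
    then show ?thesis by simp
  qed
  let ?h = "\<lambda>A. of_bool (card A \<le> k) :: real" and ?h' = "\<lambda>A. of_bool (Suc (card A) \<le> k) :: real"
  have b: "bexp (?S x) p ?h = bcdf (n - 2) p k" "bexp (?S x) p ?h' = shifted" if "x = u \<or> x = v" for x
    using that cS prob_shifted[of "?S x"] bprob_card_le[of "?S x" p k] by (auto simp: bprob_def)
  have "bexp (all_edges n) p (\<lambda>E. of_bool (low n k u E) * of_bool (low n k v E)) =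
      p * bexp ?F p (\<lambda>A. ?h' (A \<inter> ?S u) * ?h' (A \<inter> ?S v)) +
      (1 - p) * bexp ?F p (\<lambda>A. ?h (A \<inter> ?S u) * ?h (A \<inter> ?S v))"
    unfolding low_def by (subst F, subst bexp_insert)
      (auto intro!: arg_cong2[of _ _ _ _ "(+)"] arg_cong2[of _ _ _ _ "(*)"] bexp_cong simp: inn out e
        simp del: Int_insert_left Int_insert_left_if1 Int_insert_left_if0)
  also have "bexp ?F p (\<lambda>A. ?h' (A \<inter> ?S u) * ?h' (A \<inter> ?S v)) = shifted * shifted"
    using bexp_indep[OF _ SF dis, of p ?h' ?h'] by (simp add: b)
  also have "bexp ?F p (\<lambda>A. ?h (A \<inter> ?S u) * ?h (A \<inter> ?S v)) = bcdf (n - 2) p k * bcdf (n - 2) p k"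
    using bexp_indep[OF _ SF dis, of p ?h ?h] by (simp add: b)
  finally show ?pair by (simp only: power2_eq_square)
  have "bcdf (n - 1) p k = bexp (all_edges n) p (\<lambda>E. of_bool (low n k u E))"
    using prob_low[OF u] by (simp add: bprob_def)
  also have "\<dots> = p * bexp ?F p (\<lambda>A. ?h' (A \<inter> ?S u)) + (1 - p) * bexp ?F p (\<lambda>A. ?h (A \<inter> ?S u))"
    unfolding low_def by (subst F, subst bexp_insert)
      (auto intro!: arg_cong2[of _ _ _ _ "(+)"] arg_cong2[of _ _ _ _ "(*)"] bexp_cong simp: inn out e
        simp del: Int_insert_left Int_insert_left_if1 Int_insert_left_if0)
  also have "\<dots> = p * shifted + (1 - p) * bcdf (n - 2) p k"
    using bexp_restrict[OF _ SF(1), of p ?h] bexp_restrict[OF _ SF(1), of p ?h'] by (simp add: b)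
  finally show ?single .
qed

text \<open>Chebyshev's inequality for the number X of low vertices: on the event X = 0 the squared
  deviation is (n q)^2. By the two formulas of \<open>prob_low_pair\<close>, the covariance of a
  pair is p (1 - p) (b - a)^2 with a = \<open>shifted\<close> and b =
  \<open>bcdf (n - 2) p k\<close>, hence at most p b^2, and b \<le> q / (1 - p).\<close>

lemma prob_no_low_vertex:
  assumes p1: "p < 1" and q: "0 < bcdf (n - 1) p k" and n: "n \<ge> 1"
  shows "bprob (all_edges n) p (\<lambda>E. \<forall>v\<in>{1..n}. \<not> low n k v E)
    \<le> 1 / (real n * bcdf (n - 1) p k) + p / (1 - p)\<^sup>2"
proof -
  let ?F = "all_edges n" and ?V = "{1..n}" and ?q = "bcdf (n - 1) p k"
  let ?I = "\<lambda>v E. of_bool (low n k v E) :: real"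
  let ?X = "\<lambda>E. \<Sum>v\<in>?V. ?I v E"
  have EI: "bexp ?F p (?I v) = ?q" if "v \<in> ?V" for v
    using prob_low[OF that] by (simp add: bprob_def)
  have cov: "bexp ?F p (\<lambda>E. ?I u E * ?I v E) \<le> ?q\<^sup>2 + p * ?q\<^sup>2 / (1 - p)\<^sup>2 + (if u = v then ?q else 0)"
    if u: "u \<in> ?V" and v: "v \<in> ?V" for u v
  proof (cases "u = v")
    case True
    have "bexp ?F p (\<lambda>E. ?I u E * ?I v E) = bexp ?F p (?I u)"
      using True by (intro bexp_cong) simp
    then have "bexp ?F p (\<lambda>E. ?I u E * ?I v E) = ?q" using EI[OF u] by simp
    moreover have "0 \<le> ?q\<^sup>2 + p * ?q\<^sup>2 / (1 - p)\<^sup>2" using p by simp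
    ultimately show ?thesis using True by simp
  next
    case False
    let ?a = shifted and ?b = "bcdf (n - 2) p k"
    note pair = prob_low_pair[OF u v False]
    have "(1 - p) * ?b \<le> ?q" using pair(2) p shifted_bounds(1) by simp
    then have "?b \<le> ?q / (1 - p)" using p1 by (simp add: field_simps)
    then have b2: "?b\<^sup>2 \<le> (?q / (1 - p))\<^sup>2" using p by (intro power_mono bcdf_nonneg) auto
    have "p * ?a\<^sup>2 + (1 - p) * ?b\<^sup>2 = ?q\<^sup>2 + p * (1 - p) * (?b - ?a)\<^sup>2"
      unfolding pair(2) by (simp add: power2_eq_square algebra_simps)
    also have "\<dots> \<le> ?q\<^sup>2 + p * 1 * ?b\<^sup>2"
      using p shifted_bounds by (intro add_left_mono mult_mono power_mono) auto
    also have "\<dots> \<le> ?q\<^sup>2 + p * (?q / (1 - p))\<^sup>2" using b2 p by (simp add: mult_left_mono)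
    finally show ?thesis using False unfolding pair(1) by (simp add: power_divide)
  qed
  have "bprob ?F p (\<lambda>E. \<forall>v\<in>?V. \<not> low n k v E) * (real n * ?q)\<^sup>2
      = bexp ?F p (\<lambda>E. of_bool (\<forall>v\<in>?V. \<not> low n k v E) * (real n * ?q)\<^sup>2)"
    by (simp add: bprob_def bexp_multc)
  also have "\<dots> \<le> bexp ?F p (\<lambda>E. (?X E - real n * ?q)\<^sup>2)"
  proof (rule bexp_mono[OF p])
    fix E
    have "?X E = 0" if "\<forall>v\<in>?V. \<not> low n k v E" using that by (intro sum.neutral) auto
    then show "of_bool (\<forall>v\<in>?V. \<not> low n k v E) * (real n * ?q)\<^sup>2 \<le> (?X E - real n * ?q)\<^sup>2"
      by (cases "\<forall>v\<in>?V. \<not> low n k v E") (simp_all only: of_bool_eq, simp_all)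
  qed
  also have "\<dots> = bexp ?F p (\<lambda>E. (\<Sum>u\<in>?V. \<Sum>v\<in>?V. ?I u E * ?I v E) +
      ((\<Sum>v\<in>?V. (- 2 * (real n * ?q)) * ?I v E) + (real n * ?q)\<^sup>2))"
  proof -
    have "(x - c)\<^sup>2 = x * x + ((- 2 * c) * x + c\<^sup>2)" for x c :: real
      by (simp add: power2_eq_square algebra_simps)
    then show ?thesis
      unfolding sum_product[symmetric] unfolding sum_distrib_left[symmetric] by (intro bexp_cong)
  qed
  also have "\<dots> = (\<Sum>u\<in>?V. \<Sum>v\<in>?V. bexp ?F p (\<lambda>E. ?I u E * ?I v E)) - (real n * ?q)\<^sup>2"
  proof -
    have "(\<Sum>v\<in>?V. bexp ?F p (\<lambda>E. (- 2 * (real n * ?q)) * ?I v E)) = (\<Sum>v\<in>?V. (- 2 * (real n * ?q)) * ?q)"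
      by (intro sum.cong) (simp_all only: bexp_cmult EI)
    also have "\<dots> = - 2 * (real n * ?q)\<^sup>2" by (simp add: power2_eq_square)
    finally show ?thesis unfolding bexp_add bexp_sum by simp
  qed
  also have "(\<Sum>u\<in>?V. \<Sum>v\<in>?V. bexp ?F p (\<lambda>E. ?I u E * ?I v E)) \<le>
      (\<Sum>u\<in>?V. \<Sum>v\<in>?V. ?q\<^sup>2 + p * ?q\<^sup>2 / (1 - p)\<^sup>2 + (if u = v then ?q else 0))"
    by (intro sum_mono cov)
  also have "\<dots> = (real n * ?q)\<^sup>2 * (1 + p / (1 - p)\<^sup>2) + real n * ?q"
    by (simp add: sum.distrib power2_eq_square algebra_simps)
  finally have "bprob ?F p (\<lambda>E. \<forall>v\<in>?V. \<not> low n k v E) * (real n * ?q)\<^sup>2 \<le>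
      (real n * ?q)\<^sup>2 * (p / (1 - p)\<^sup>2) + real n * ?q"
    by (simp only: distrib_left) simp
  moreover have "B \<le> 1 / y + r" if "B * y\<^sup>2 \<le> y\<^sup>2 * r + y" "0 < y" for B y r :: real
  proof -
    have "(1 / y + r) * y\<^sup>2 = y\<^sup>2 * r + y"
      using that(2) by (simp add: power2_eq_square field_simps)
    then have "B * y\<^sup>2 \<le> (1 / y + r) * y\<^sup>2" using that(1) by linarith
    then show ?thesis by (rule mult_right_le_imp_le) (use that(2) in simp)
  qed
  moreover have "0 < real n * ?q" using q n by simp
  ultimately show ?thesis by blast
qed

text \<open>Being low is relaxed to having at most k edges in a subset of the star. The three events
  then live on the disjoint sets W, S and S' and become independent, at the price of slightly
  smaller stars.\<close>

lemma prob_edges_low_low: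
  assumes W: "W \<subseteq> all_edges n" and S: "S \<subseteq> star n u - W" "S' \<subseteq> star n v - W" "S \<inter> S' = {}"
  shows "bprob (all_edges n) p (\<lambda>E. W \<subseteq> E \<and> low n k u E \<and> low n k v E)
    \<le> p ^ card W * (bcdf (card S) p k * bcdf (card S') p k)"
proof -
  let ?F = "all_edges n"
  have fin: "finite W" "finite S" "finite S'"
    using W S by (auto intro: finite_subset[OF _ finite_all_edges] finite_subset[OF _ finite_star])
  have sub: "S \<subseteq> ?F" "S' \<subseteq> ?F" "W \<inter> (S \<union> S') = {}" using S by (auto simp: star_def)
  have "bprob ?F p (\<lambda>E. W \<subseteq> E \<and> low n k u E \<and> low n k v E) \<le>
      bexp ?F p (\<lambda>E. (\<lambda>A. of_bool (A = W)) (E \<inter> W) *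
        (\<lambda>A. of_bool (card (A \<inter> S) \<le> k) * of_bool (card (A \<inter> S') \<le> k)) (E \<inter> (S \<union> S')))"
    unfolding bprob_def
  proof (rule bexp_mono[OF p])
    fix E assume "E \<subseteq> ?F"
    have I: "E \<inter> (S \<union> S') \<inter> S = E \<inter> S" "E \<inter> (S \<union> S') \<inter> S' = E \<inter> S'" by auto
    have "card (E \<inter> S) \<le> card (E \<inter> star n u)" "card (E \<inter> S') \<le> card (E \<inter> star n v)"
      using S by (auto intro!: card_mono)
    then show "(of_bool (W \<subseteq> E \<and> low n k u E \<and> low n k v E) :: real) \<le>
        (\<lambda>A. of_bool (A = W)) (E \<inter> W) *
        (\<lambda>A. of_bool (card (A \<inter> S) \<le> k) * of_bool (card (A \<inter> S') \<le> k)) (E \<inter> (S \<union> S'))"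
      unfolding I low_def by (auto simp: Int_absorb1)
  qed
  also have "\<dots> = bexp W p (\<lambda>A. of_bool (A = W)) *
      bexp (S \<union> S') p (\<lambda>A. of_bool (card (A \<inter> S) \<le> k) * of_bool (card (A \<inter> S') \<le> k))"
    using W sub by (intro bexp_indep) auto
  also have "bexp W p (\<lambda>A. of_bool (A = W)) = p ^ card W"
  proof -
    have "bexp W p (\<lambda>A. of_bool (A = W)) = (\<Sum>A\<in>{W}. p ^ card A)"
      unfolding bexp_def using fin by (intro sum.mono_neutral_cong_right) auto
    then show ?thesis by simp
  qed
  also have "bexp (S \<union> S') p (\<lambda>A. of_bool (card (A \<inter> S) \<le> k) * of_bool (card (A \<inter> S') \<le> k)) =
      bexp S p (\<lambda>A. of_bool (card A \<le> k)) * bexp S' p (\<lambda>A. of_bool (card A \<le> k))"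
    using fin S(3) by (intro bexp_indep[where g = "\<lambda>A. of_bool (card A \<le> k)" and h = "\<lambda>A. of_bool (card A \<le> k)"]) auto
  finally show ?thesis using fin by (simp add: bprob_card_le[unfolded bprob_def])
qed

lemma bcdf_minus_le:
  assumes "p \<le> 1/2" "j \<le> N"
  shows "bcdf (N - j) p k \<le> 2 ^ j * bcdf N p k"
  using assms(2)
proof (induction j)
  case (Suc j)
  have N: "N - j = Suc (N - Suc j)" using Suc.prems by simp
  have "1/2 * bcdf (N - Suc j) p k \<le> (1 - p) * bcdf (N - Suc j) p k"
    using assms(1) p by (intro mult_right_mono bcdf_nonneg) auto
  also have "\<dots> \<le> bcdf (N - j) p k" unfolding N by (rule bcdf_Suc_ge[OF p])
  finally show ?case using Suc by simp
qed simp

text \<open>A union bound over pairs for adjacency and over triples for a common neighbour. Each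
  edge removed from a star costs a factor 2 by \<open>bcdf_minus_le\<close>: one edge per star gives
  2 * 2 = 4, two edges per star give 4 * 4 = 16.\<close>

lemma prob_close_low_pair:
  assumes p2: "p \<le> 1/2" and n: "n \<ge> 3"
  shows "bprob (all_edges n) p (\<lambda>E. \<exists>u\<in>{1..n}. \<exists>v\<in>{1..n}. u \<noteq> v \<and> low n k u E \<and> low n k v E \<and>
      ({u, v} \<in> E \<or> (\<exists>w\<in>{1..n} - {u, v}. {u, w} \<in> E \<and> {v, w} \<in> E)))
    \<le> (4 * real n ^ 2 * p + 16 * real n ^ 3 * p\<^sup>2) * (bcdf (n - 1) p k)\<^sup>2"
proof -
  let ?F = "all_edges n" and ?V = "{1..n}" and ?q = "bcdf (n - 1) p k"
  let ?L = "\<lambda>u v E. low n k u E \<and> low n k v E"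
  define I2 where "I2 = {(u, v). u \<in> ?V \<and> v \<in> ?V \<and> u \<noteq> v}"
  define I3 where "I3 = {(u, v, w). u \<in> ?V \<and> v \<in> ?V \<and> w \<in> ?V \<and> u \<noteq> v \<and> w \<noteq> u \<and> w \<noteq> v}"
  have sub2: "I2 \<subseteq> ?V \<times> ?V" and sub3: "I3 \<subseteq> ?V \<times> ?V \<times> ?V" by (auto simp: I2_def I3_def)
  have fin: "finite I2" "finite I3"
    by (rule finite_subset[OF sub2], simp, rule finite_subset[OF sub3], simp)
  have c2: "real (card I2) \<le> real n ^ 2"
    using card_mono[OF _ sub2] by (simp add: power2_eq_square flip: of_nat_mult)
  have c3: "real (card I3) \<le> real n ^ 3"
    using card_mono[OF _ sub3] by (simp add: power3_eq_cube flip: of_nat_mult)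
  let ?P2 = "\<lambda>(u, v) E. {{u, v}} \<subseteq> E \<and> ?L u v E"
  let ?P3 = "\<lambda>(u, v, w) E. {{u, w}, {v, w}} \<subseteq> E \<and> ?L u v E"
  have b2: "bprob ?F p (?P2 i) \<le> 4 * p * ?q\<^sup>2" if i: "i \<in> I2" for i
  proof -
    obtain u v where uv: "i = (u, v)" "u \<in> ?V" "v \<in> ?V" "u \<noteq> v" using i by (auto simp: I2_def)
    let ?S = "\<lambda>x. star n x - {{u, v}}"
    have e: "{u, v} \<in> star n u" "{u, v} \<in> star n v" using pair_in_star[OF uv(2-4)] by auto
    have c: "card (?S u) = (n - 1) - 1" "card (?S v) = (n - 1) - 1"
      using e card_star[OF uv(2)] card_star[OF uv(3)] by simp_all
    have "bprob ?F p (?P2 i) \<le> p ^ card {{u, v}} * (bcdf (card (?S u)) p k * bcdf (card (?S v)) p k)"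
      using e star_Int[OF uv(4)] unfolding uv(1) prod.case
      by (intro prob_edges_low_low) (auto simp: star_def)
    also have "\<dots> \<le> p ^ card {{u, v}} * ((2 ^ 1 * ?q) * (2 ^ 1 * ?q))"
      unfolding c using p p2 n by (intro mult_left_mono mult_mono bcdf_minus_le bcdf_nonneg mult_nonneg_nonneg) auto
    finally show ?thesis by (simp add: power2_eq_square)
  qed
  have b3: "bprob ?F p (?P3 i) \<le> 16 * p\<^sup>2 * ?q\<^sup>2" if i: "i \<in> I3" for i
  proof -
    obtain u v w where uvw: "i = (u, v, w)" "u \<in> ?V" "v \<in> ?V" "w \<in> ?V" "u \<noteq> v" "u \<noteq> w" "v \<noteq> w"
      using i by (auto simp: I3_def)
    \<comment> \<open>The edge {u, v} goes because both stars contain it, the edge {x, w} because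
      its presence is prescribed.\<close>
    let ?S = "\<lambda>x. star n x - {{u, v}, {x, w}}"
    have e: "{u, v} \<in> star n u" "{u, v} \<in> star n v" "{u, w} \<in> star n u" "{v, w} \<in> star n v"
      "{v, w} \<notin> star n u" "{u, w} \<notin> star n v"
      using pair_in_star[OF uvw(2,3,5)] pair_in_star[OF uvw(2,4,6)] pair_in_star[OF uvw(3,4,7)] uvw(5-7)
      by (auto simp: star_def)
    have ne: "{u, v} \<noteq> {u, w}" "{u, v} \<noteq> {v, w}" "{u, w} \<noteq> {v, w}"
      using uvw(5-7) by (auto simp: doubleton_eq_iff)
    have c: "card (?S u) = (n - 1) - 2" "card (?S v) = (n - 1) - 2"
      using e ne card_star[OF uvw(2)] card_star[OF uvw(3)] by (simp_all add: card_Diff_subset)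
    have "bprob ?F p (?P3 i) \<le> p ^ card {{u, w}, {v, w}} * (bcdf (card (?S u)) p k * bcdf (card (?S v)) p k)"
      using e star_Int[OF uvw(5)] unfolding uvw(1) prod.case
      by (intro prob_edges_low_low) (auto simp: star_def)
    also have "\<dots> \<le> p ^ card {{u, w}, {v, w}} * ((2 ^ 2 * ?q) * (2 ^ 2 * ?q))"
      unfolding c using p p2 n by (intro mult_left_mono mult_mono bcdf_minus_le bcdf_nonneg mult_nonneg_nonneg) auto
    finally show ?thesis using ne by (simp add: power2_eq_square)
  qed
  have "bprob ?F p (\<lambda>E. \<exists>u\<in>?V. \<exists>v\<in>?V. u \<noteq> v \<and> low n k u E \<and> low n k v E \<and>
      ({u, v} \<in> E \<or> (\<exists>w\<in>?V - {u, v}. {u, w} \<in> E \<and> {v, w} \<in> E)))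
      \<le> bprob ?F p (\<lambda>E. (\<exists>i\<in>I2. ?P2 i E) \<or> (\<exists>i\<in>I3. ?P3 i E))"
  proof (rule bprob_mono[OF p])
    fix E assume "\<exists>u\<in>?V. \<exists>v\<in>?V. u \<noteq> v \<and> low n k u E \<and> low n k v E \<and>
      ({u, v} \<in> E \<or> (\<exists>w\<in>?V - {u, v}. {u, w} \<in> E \<and> {v, w} \<in> E))"
    then obtain u v where uv: "u \<in> ?V" "v \<in> ?V" "u \<noteq> v" "?L u v E"
      and or: "{u, v} \<in> E \<or> (\<exists>w\<in>?V - {u, v}. {u, w} \<in> E \<and> {v, w} \<in> E)" by blast
    from or show "(\<exists>i\<in>I2. ?P2 i E) \<or> (\<exists>i\<in>I3. ?P3 i E)"
    proof
      assume "{u, v} \<in> E"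
      then have "(u, v) \<in> I2" "?P2 (u, v) E" using uv by (auto simp: I2_def)
      then show ?thesis by (intro disjI1 bexI)
    next
      assume "\<exists>w\<in>?V - {u, v}. {u, w} \<in> E \<and> {v, w} \<in> E"
      then obtain w where "w \<in> ?V - {u, v}" "{u, w} \<in> E" "{v, w} \<in> E" by blast
      then have "(u, v, w) \<in> I3" "?P3 (u, v, w) E" using uv by (auto simp: I3_def)
      then show ?thesis by (intro disjI2 bexI)
    qed
  qed
  also have "\<dots> \<le> (\<Sum>i\<in>I2. bprob ?F p (?P2 i)) + (\<Sum>i\<in>I3. bprob ?F p (?P3 i))"
    using bprob_union_bound[OF p fin(1), of ?F ?P2] bprob_union_bound[OF p fin(2), of ?F ?P3]
    by (intro order_trans[OF bprob_disj[OF p]] add_mono)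
  also have "\<dots> \<le> (\<Sum>i\<in>I2. 4 * p * ?q\<^sup>2) + (\<Sum>i\<in>I3. 16 * p\<^sup>2 * ?q\<^sup>2)"
    by (intro add_mono sum_mono b2 b3)
  also have "\<dots> = real (card I2) * (4 * p * ?q\<^sup>2) + real (card I3) * (16 * p\<^sup>2 * ?q\<^sup>2)" by simp
  also have "\<dots> \<le> real n ^ 2 * (4 * p * ?q\<^sup>2) + real n ^ 3 * (16 * p\<^sup>2 * ?q\<^sup>2)"
    using c2 c3 p by (intro add_mono mult_right_mono) auto
  finally show ?thesis by (simp add: algebra_simps)
qed

end

section \<open>The two ranges of the edge probability\<close>

abbreviation (input) packing_formula :: "nat \<Rightarrow> nat set set \<Rightarrow> bool" where
  "packing_formula n E \<equiv> tree_packing n E = min (min_degree n E) (card E div (n - 1))"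

lemma prob_exists_set:
  assumes p: "0 \<le> p" "p \<le> 1" and V: "finite V" and z: "0 \<le> z"
    and Q: "\<And>S. S \<subseteq> V \<Longrightarrow> S \<noteq> {} \<Longrightarrow> bprob F p (Q S) \<le> z ^ card S"
  shows "bprob F p (\<lambda>E. \<exists>S\<in>Pow V - {{}}. Q S E) \<le> (1 + z) ^ card V - 1"
proof -
  have "bprob F p (\<lambda>E. \<exists>S\<in>Pow V - {{}}. Q S E) \<le> (\<Sum>S\<in>Pow V - {{}}. bprob F p (Q S))"
    using p V by (intro bprob_union_bound) auto
  also have "\<dots> \<le> (\<Sum>S\<in>Pow V - {{}}. z ^ card S)" by (intro sum_mono Q) auto
  also have "\<dots> = (\<Sum>S\<in>Pow V. z ^ card S) - 1"
    using V by (subst sum_diff) auto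
  finally show ?thesis using V by (simp add: sum_power_card)
qed

text \<open>For sets of linear size, where a bound of the form exp (- c n ln n) beats the number 2^n
  of all sets.\<close>

lemma prob_exists_set_uniform:
  assumes p: "0 \<le> p" "p \<le> 1" and V: "finite V"
    and Q: "\<And>S. S \<subseteq> V \<Longrightarrow> bprob F p (Q S) \<le> y"
  shows "bprob F p (\<lambda>E. \<exists>S\<in>Pow V. Q S E) \<le> 2 ^ card V * y"
proof -
  have "bprob F p (\<lambda>E. \<exists>S\<in>Pow V. Q S E) \<le> (\<Sum>S\<in>Pow V. bprob F p (Q S))"
    using p V by (intro bprob_union_bound) auto
  also have "\<dots> \<le> (\<Sum>S\<in>Pow V. y)" by (intro sum_mono Q) auto
  finally show ?thesis using V by (simp add: card_Pow)
qed

text \<open>Moves a size condition on S, which does not involve the random set, into the event, so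
  that union bounds can range over all subsets.\<close>

lemma bprob_guard:
  assumes "P \<Longrightarrow> bprob F p Q \<le> y" "0 \<le> y"
  shows "bprob F p (\<lambda>E. P \<and> Q E) \<le> y"
  using assms by (cases P) (auto simp: bprob_def bexp_def)

lemma real_packing_bound:
  assumes "n \<ge> 2" "real (card E) < D * (real n - 1)"
  shows "real (min (min_degree n E) (card E div (n - 1))) \<le> D"
proof -
  let ?T = "min (min_degree n E) (card E div (n - 1))"
  have "?T * (n - 1) \<le> card E div (n - 1) * (n - 1)" by (intro mult_right_mono) auto
  also have "\<dots> \<le> card E" by simp
  finally have "real (?T * (n - 1)) \<le> real (card E)" by (simp only: of_nat_le_iff)
  then have "real ?T * (real n - 1) \<le> real (card E)" using assms(1) by (simp add: of_nat_diff)
  also have "\<dots> \<le> D * (real n - 1)" using assms(2) by simp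
  finally show ?thesis using assms(1) by (simp only: mult_le_cancel_right)
qed

lemma min_degree_le: "v \<in> {1..n} \<Longrightarrow> min_degree n E \<le> degree E v"
  unfolding min_degree_def by (intro Min_le) auto

lemma exp_neg_le_inverse_square:
  assumes "n \<ge> 1" "2 * ln (real n) \<le> y"
  shows "exp (- y * real s) \<le> (1 / real n ^ 2) ^ s"
proof -
  have "exp (- y * real s) = exp (- y) ^ s" by (simp add: exp_of_nat_mult[symmetric] mult.commute)
  also have "exp (- y) \<le> exp (- (2 * ln (real n)))" using assms by simp
  then have "exp (- y) ^ s \<le> exp (- (2 * ln (real n))) ^ s" by (intro power_mono) auto
  also have "exp (- (2 * ln (real n))) = 1 / real n ^ 2"
    using assms(1) by (simp add: exp_minus exp_double inverse_eq_divide)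
  finally show ?thesis .
qed

definition err_dense :: "nat \<Rightarrow> real" where
  "err_dense n = 2 * exp (- (640 * ln (real n)) * (real n - 1) / 5000)
     + 2 * ((1 + 1 / real n ^ 2) ^ n - 1)"

lemma prob_fail_dense:
  assumes p: "0 \<le> p" "p \<le> 1" and n: "n \<ge> 3" and d: "640 * ln (real n) \<le> real n * p"
  shows "bprob (all_edges n) p (\<lambda>E. \<not> packing_formula n E) \<le> err_dense n"
proof -
  define d where "d = real n * p"
  let ?F = "all_edges n" and ?V = "{1..n}"
  let ?M = "\<lambda>E. real (card E) \<le> 0.475 * d * (real n - 1) \<or> 0.525 * d * (real n - 1) \<le> real (card E)"
  let ?I = "\<lambda>S E. (2 \<le> card S \<and> 4 * card S \<le> 3 * n) \<and>
      0.475 * d * (real (card S) - 1) \<le> real (card (inner_edges E S))"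
  let ?B = "\<lambda>R E. (4 * card R \<le> n) \<and> real (card (boundary E R)) \<le> 0.525 * d * real (card R)"
  \<comment> \<open>The origin of 640 = 2 * 320: the rate d / 320 per vertex is at least 2 ln n, so
    the union bound runs with z = n^-2 and (1 + z)^n - 1 tends to 0.\<close>
  have small: "exp (- d * real s / 320) \<le> (1 / real n ^ 2) ^ s" for s
    using exp_neg_le_inverse_square[of n "d / 320" s] d n by (simp add: d_def)
  have M: "bprob ?F p ?M \<le> 2 * exp (- (640 * ln (real n)) * (real n - 1) / 5000)"
  proof -
    have "640 * ln (real n) * (real n - 1) \<le> d * (real n - 1)"
      using d n by (intro mult_right_mono) (auto simp: d_def)
    then have "2 * exp (- d * (real n - 1) / 5000) \<le> 2 * exp (- (640 * ln (real n)) * (real n - 1) / 5000)"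
      by simp
    with n show ?thesis by (intro order_trans[OF prob_edge_count[OF p d_def]]) auto
  qed
  have I: "bprob ?F p (\<lambda>E. \<exists>S\<in>Pow ?V - {{}}. ?I S E) \<le> (1 + 1 / real n ^ 2) ^ card ?V - 1"
  proof (rule prob_exists_set[OF p])
    fix S assume S: "S \<subseteq> ?V"
    show "bprob ?F p (?I S) \<le> (1 / real n ^ 2) ^ card S"
      using prob_inner_dense[OF p d_def S] small[of "card S"]
      by (intro bprob_guard) (auto intro: order_trans)
  qed auto
  have B: "bprob ?F p (\<lambda>E. \<exists>S\<in>Pow ?V - {{}}. ?B S E) \<le> (1 + 1 / real n ^ 2) ^ card ?V - 1"
  proof (rule prob_exists_set[OF p])
    fix S assume S: "S \<subseteq> ?V"
    show "bprob ?F p (?B S) \<le> (1 / real n ^ 2) ^ card S"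
      using prob_boundary_sparse[OF p d_def S] small[of "card S"]
      by (intro bprob_guard) (auto intro: order_trans)
  qed auto
  have "bprob ?F p (\<lambda>E. \<not> packing_formula n E) \<le>
      bprob ?F p (\<lambda>E. ?M E \<or> (\<exists>S\<in>Pow ?V - {{}}. ?I S E) \<or> (\<exists>S\<in>Pow ?V - {{}}. ?B S E))"
  proof (rule bprob_mono[OF p], rule ccontr)
    fix E assume E: "E \<subseteq> ?F" and fail: "\<not> packing_formula n E"
      and "\<not> (?M E \<or> (\<exists>S\<in>Pow ?V - {{}}. ?I S E) \<or> (\<exists>S\<in>Pow ?V - {{}}. ?B S E))"
    then have M: "\<not> ?M E" and I: "\<And>S. S \<subseteq> ?V \<Longrightarrow> S \<noteq> {} \<Longrightarrow> \<not> ?I S E"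
      and B: "\<And>S. S \<subseteq> ?V \<Longrightarrow> S \<noteq> {} \<Longrightarrow> \<not> ?B S E" by blast+
    have "packing_formula n E"
    proof (rule packing_eq_if_dense[OF _ E refl, where D = "0.475 * d"])
      fix S assume "S \<subseteq> ?V" "2 \<le> card S" "4 * card S \<le> 3 * n"
      then show "real (card (inner_edges E S)) \<le> 0.475 * d * (real (card S) - 1)"
        using I[of S] by fastforce
    next
      fix R assume R: "R \<subseteq> ?V" "R \<noteq> {}" "4 * card R < n"
      let ?T = "min (min_degree n E) (card E div (n - 1))"
      have "real ?T * real (card R) \<le> 0.525 * d * real (card R)"
        using n M by (intro mult_right_mono real_packing_bound) auto
      also have "\<dots> \<le> real (card (boundary E R))" using B[of R] R by linarith
      finally have "real (?T * card R) \<le> real (card (boundary E R))" by simp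
      then show "?T * card R \<le> card (boundary E R)" by (simp only: of_nat_le_iff)
    qed (use n M in auto)
    with fail show False by contradiction
  qed
  also have "\<dots> \<le> bprob ?F p ?M + (bprob ?F p (\<lambda>E. \<exists>S\<in>Pow ?V - {{}}. ?I S E) +
      bprob ?F p (\<lambda>E. \<exists>S\<in>Pow ?V - {{}}. ?B S E))"
    by (intro order_trans[OF bprob_disj[OF p]] add_mono order_refl)
  also have "\<dots> \<le> err_dense n" using M I B by (simp add: err_dense_def)
  finally show ?thesis .
qed

text \<open>The constants are chosen so that \<open>n p \<le> 640 ln n\<close> gives
  \<open>exp (2 n p / 25600) * 25600 powr (\<eta> n p) \<le> n powr 0.075\<close> (few vertices have degree at most \<open>\<eta> n p\<close>
  above the minimum), and \<open>\<eta> / 4 * ln X\<^sub>0 = 9\<close> (the union bound over sets of size at most \<open>n / X\<^sub>0\<close>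
  converges).\<close>

definition \<eta> :: real where "\<eta> = 1 / (25600 * ln 25600)"
definition X\<^sub>0 :: real where "X\<^sub>0 = exp (36 / \<eta>)"

lemma eta_bounds: "0 < \<eta>" "\<eta> \<le> 1 / 25600"
proof -
  have "exp 1 \<le> (25600 :: real)" using exp_le by (rule order_trans) simp
  then have "1 \<le> ln (25600 :: real)" by (subst ln_ge_iff) auto
  then show "0 < \<eta>" "\<eta> \<le> 1 / 25600" by (auto simp: \<eta>_def field_simps)
qed

lemma X0_ge_1: "1 \<le> X\<^sub>0"
  using eta_bounds by (simp add: X\<^sub>0_def)

text \<open>The summands belong, in this order, to: no vertex of degree at most k (the first two),
  the edge count, sets of linear size that are too dense or have too small a boundary, small dense
  sets, and close pairs of light vertices. The last one is n^(1 - 1.65) up to logarithms.\<close>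

definition err_sparse :: "nat \<Rightarrow> real" where
  "err_sparse n = 1 / real n powr 0.1 + 4 * (640 * ln (real n) / real n)
     + 2 * exp (- (ln (real n) / 4) * (real n - 1) / 5000)
     + 2 * (2 ^ n * exp (- (ln (real n) / 4) * (real n / X\<^sub>0) / 320))
     + ((1 + 1 / real n ^ 2) ^ n - 1)
     + (4 * real n * (640 * ln (real n)) + 16 * real n * (640 * ln (real n))\<^sup>2)
         * (25600 * real n powr (- 0.825))\<^sup>2"

lemma err_dense_tendsto: "err_dense \<longlonglongrightarrow> 0"
  unfolding err_dense_def by real_asymp

lemma err_sparse_tendsto: "err_sparse \<longlonglongrightarrow> 0"
proof -
  have "0 < X\<^sub>0" using X0_ge_1 by simp
  then show ?thesis unfolding err_sparse_def by real_asymp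
qed

text \<open>Later applied with k - 1 in place of k, the last level that is still rare; this explains
  the \<open>Suc\<close>. That extra level costs the factor 25600, and the remaining factor is at
  most exp (3 d / 25600) \<le> n^0.075, since 3 * 640 / 25600 = 0.075.\<close>

lemma light_tail_bound:
  assumes p: "0 \<le> p" "p \<le> 1/2" and n: "n \<ge> 1" and d: "real n * p \<le> 640 * ln (real n)"
    and q: "bcdf (n - 1) p k \<le> real n powr (- 0.9)"
  shows "bcdf (n - 1) p (Suc k + nat \<lfloor>\<eta> * (real n * p)\<rfloor>) \<le> 25600 * real n powr (- 0.825)"
proof -
  define d where "d = real n * p"
  let ?x = "1 / 25600 :: real" and ?L = "ln 25600 :: real"
  let ?j = "Suc (nat \<lfloor>\<eta> * d\<rfloor>)"
  have d0: "0 \<le> d" "d \<le> 640 * ln (real n)" using p d by (auto simp: d_def)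
  have L: "0 < ?L" by simp
  have nd: "real (n - 1) * p \<le> d" unfolding d_def using p by (intro mult_right_mono) auto
  have j: "real ?j \<le> \<eta> * d + 1" using eta_bounds d0 by (simp add: of_nat_nat)
  have "1 / ?x ^ ?j = exp ?L ^ ?j" by (simp add: power_one_over)
  also have "\<dots> = exp (?L * real ?j)" by (rule exp_of_nat2_mult[symmetric])
  also have "\<dots> \<le> exp (?L * (\<eta> * d + 1))" using j L by (simp del: of_nat_Suc)
  also have "?L * (\<eta> * d + 1) = d / 25600 + ?L" using L by (simp add: \<eta>_def field_simps)
  finally have x: "1 / ?x ^ ?j \<le> exp (d / 25600 + ?L)" .
  have "bcdf (n - 1) p (k + ?j) \<le> bcdf (n - 1) p k * (exp (2 * d * ?x) / ?x ^ ?j)"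
    using p nd by (intro bcdf_add_le) auto
  also have "\<dots> = bcdf (n - 1) p k * (exp (2 * d * ?x) * (1 / ?x ^ ?j))" by simp
  also have "\<dots> \<le> real n powr (- 0.9) * (exp (2 * d * ?x) * exp (d / 25600 + ?L))"
    using q x p by (intro mult_mono mult_left_mono bcdf_nonneg) auto
  also have "\<dots> = real n powr (- 0.9) * (25600 * exp (3 * d / 25600))"
    by (simp add: exp_add[symmetric] exp_add)
  also have "\<dots> \<le> real n powr (- 0.9) * (25600 * real n powr 0.075)"
    using d0 n by (intro mult_left_mono) (auto simp: powr_def)
  also have "\<dots> = 25600 * real n powr (- 0.825)"
    using n by (simp add: powr_add[symmetric])
  finally show ?thesis by (simp add: d_def)
qed

text \<open>The hypothesis bounds the probability (1 - p)^(n - 1) \<ge> exp (- 2 p (n - 1)) that a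
  vertex is isolated, which forces n p above 0.45 ln n. So d tends to infinity whenever k > 0, as
  the Chernoff bounds for linear sets require.\<close>

lemma edge_prob_lower:
  assumes p: "0 \<le> p" "p \<le> 1/2" and n: "n \<ge> 2"
    and q: "bcdf (n - 1) p 0 < real n powr (- 0.9)"
  shows "ln (real n) / 4 \<le> real n * p"
proof (rule ccontr)
  assume "\<not> ?thesis"
  then have less: "real n * p < ln (real n) / 4" by simp
  have "exp (- (2 * p)) \<le> 1 / (1 + 2 * p + (2 * p)\<^sup>2 / 2)" using p by (intro exp_minus_le) auto
  also have "\<dots> \<le> 1 - p"
  proof -
    have "p * (p * p) \<le> p * (1/2 * (1/2))" using p by (intro mult_left_mono mult_mono) auto
    then have "1 \<le> (1 - p) * (1 + 2 * p + (2 * p)\<^sup>2 / 2)"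
      using p by (simp add: power2_eq_square algebra_simps)
    moreover have "0 < 1 + 2 * p + (2 * p)\<^sup>2 / 2" using p by (simp add: add_pos_nonneg)
    ultimately show ?thesis by (simp add: pos_divide_le_eq)
  qed
  finally have "exp (- (2 * p)) ^ (n - 1) \<le> (1 - p) ^ (n - 1)" by (intro power_mono) auto
  also have "\<dots> = bcdf (n - 1) p 0" by (simp add: bcdf_def bpm_def)
  also have "\<dots> < real n powr (- 0.9)" by (rule q)
  also have "exp (- (2 * p)) ^ (n - 1) = exp (- (2 * p) * real (n - 1))"
    by (simp add: exp_of_nat_mult[symmetric] mult.commute)
  also have "real n powr (- 0.9) = exp (- 0.9 * ln (real n))" using n by (simp add: powr_def)
  finally have "0.9 * ln (real n) < 2 * (p * real (n - 1))" by (simp del: of_nat_diff)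
  moreover have "p * real (n - 1) \<le> p * real n" using p by (intro mult_left_mono) auto
  moreover have "p * real n < ln (real n) / 4" using less by (simp add: mult.commute)
  moreover have "0 < ln (real n)" using n by simp
  ultimately show False by linarith
qed

lemma prob_fail_sparse:
  assumes p: "0 \<le> p" "p \<le> 1" and n: "n \<ge> 3" and dn: "real n * p \<le> 640 * ln (real n)"
    and large: "640 * ln (real n) / real n \<le> 1/2" "4 \<le> \<eta> * (ln (real n) / 4)"
  shows "bprob (all_edges n) p (\<lambda>E. \<not> packing_formula n E) \<le> err_sparse n"
proof -
  define d where "d = real n * p"
  let ?F = "all_edges n" and ?V = "{1..n}" and ?q = "bcdf (n - 1) p"
  \<comment> \<open>k is with high probability an upper bound for the minimum degree, yet few vertices have degree below k\<close>
  define k where "k = (LEAST k. real n powr 0.1 \<le> real n * ?q k)"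
  have "real n powr 0.1 \<le> real n powr 1" using n by (intro powr_mono) auto
  \<comment> \<open>No degree exceeds n - 1, so the distribution function is 1 at that
    level.\<close>
  then have "\<exists>k. real n powr 0.1 \<le> real n * ?q k"
    using n bcdf_full[of "n - 1" p] by (intro exI[of _ "n - 1"]) simp
  then have k: "real n powr 0.1 \<le> real n * ?q k" unfolding k_def by (rule LeastI_ex)
  have less_k: "real n * ?q j < real n powr 0.1" if "j < k" for j
    using not_less_Least[of j "\<lambda>k. real n powr 0.1 \<le> real n * ?q k"] that unfolding k_def by simp
  have p_le: "p \<le> 640 * ln (real n) / real n" using dn n by (simp add: field_simps)
  with large have p2: "p \<le> 1/2" by linarith
  let ?N = "\<lambda>E. \<forall>v\<in>?V. \<not> low n k v E"
  let ?e1 = "1 / real n powr 0.1 + 4 * (640 * ln (real n) / real n)"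
  have pos: "0 < real n powr 0.1" using n by simp
  have N: "bprob ?F p ?N \<le> ?e1"
  proof -
    have q0: "0 < real n * ?q k" using k pos by linarith
    then have "0 < ?q k" using n by (simp add: zero_less_mult_iff)
    then have "bprob ?F p ?N \<le> 1 / (real n * ?q k) + p / (1 - p)\<^sup>2"
      using p p2 n by (intro prob_no_low_vertex) auto
    also have "1 / (real n * ?q k) \<le> 1 / real n powr 0.1"
      using k pos q0 by (intro divide_left_mono) auto
    also have "p / (1 - p)\<^sup>2 \<le> 4 * (640 * ln (real n) / real n)"
    proof -
      have "(1/2)\<^sup>2 \<le> (1 - p)\<^sup>2" using p2 by (intro power_mono) auto
      then have "p / (1 - p)\<^sup>2 \<le> p / (1/2)\<^sup>2" using p by (intro divide_left_mono) auto
      then show ?thesis using p_le by (simp add: power2_eq_square)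
    qed
    finally show ?thesis by simp
  qed
  have e3: "0 \<le> (1 + 1 / real n ^ 2) ^ n - 1" by simp
  have e4: "0 \<le> ln (real n)" using n by simp
  have deg_low: "min_degree n E \<le> k" if E: "E \<subseteq> ?F" "\<not> ?N E" for E
  proof -
    obtain v where v: "v \<in> ?V" "low n k v E" using E(2) by blast
    then have "degree E v \<le> k" using E(1) by (simp add: low_def degree_eq_card_star)
    then show ?thesis using min_degree_le[OF v(1), of E] by linarith
  qed
  show ?thesis
  proof (cases "k = 0")
    case True
    have "bprob ?F p (\<lambda>E. \<not> packing_formula n E) \<le> bprob ?F p ?N"
    proof (rule bprob_mono[OF p], rule ccontr)
      fix E assume E: "E \<subseteq> ?F" "\<not> packing_formula n E" "\<not> ?N E"
      then have "min_degree n E = 0" using deg_low True by simp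
      \<comment> \<open>Here T = 0, so the guarded conditions are vacuous, and D = 0 meets the edge
        count trivially.\<close>
      then have "packing_formula n E"
        using n by (intro packing_eq_if_dense[OF _ E(1) refl, where D = 0]) auto
      with E(2) show False by contradiction
    qed
    also have "\<dots> \<le> err_sparse n"
    proof -
      have "0 \<le> 2 * exp x" "0 \<le> 2 * (2 ^ n * exp x)" for x :: real by simp_all
      note this(1)[of "- (ln (real n) / 4) * (real n - 1) / 5000"]
        this(2)[of "- (ln (real n) / 4) * (real n / X\<^sub>0) / 320"]
      moreover have "0 \<le> (4 * real n * (640 * ln (real n)) + 16 * real n * (640 * ln (real n))\<^sup>2)
          * (25600 * real n powr (- 0.825))\<^sup>2"
        using e4 by (intro mult_nonneg_nonneg add_nonneg_nonneg) auto
      ultimately show ?thesis unfolding err_sparse_def using N e3 by linarith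
    qed
    finally show ?thesis .
  next
    case False
    have qk: "?q j < real n powr (- 0.9)" if "j < k" for j
    proof -
      have "real n * ?q j < real n * real n powr (- 0.9)"
        using less_k[OF that] n powr_add[of "real n" 1 "- 0.9"] by simp
      then show ?thesis using n by simp
    qed
    have d4: "ln (real n) / 4 \<le> d"
      unfolding d_def using p p2 n qk[of 0] False by (intro edge_prob_lower) auto
    have d0: "0 \<le> d" using p by (simp add: d_def)
    \<comment> \<open>The bound for light vertices: a degree above J is at least k + floor
      (\<open>\<eta> * d\<close>) + 1, hence at least T + \<open>\<eta> * d\<close>.\<close>
    define J where "J = k + nat \<lfloor>\<eta> * d\<rfloor>"
    have qJ: "?q J \<le> 25600 * real n powr (- 0.825)"
      using light_tail_bound[OF p(1) p2 _ dn, of "k - 1"] qk[of "k - 1"] n False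
      by (simp add: J_def d_def)
    let ?M = "\<lambda>E. real (card E) \<le> 0.475 * d * (real n - 1) \<or> 0.525 * d * (real n - 1) \<le> real (card E)"
    let ?I = "\<lambda>S E. (2 \<le> card S \<and> 4 * card S \<le> 3 * n \<and> real n \<le> X\<^sub>0 * real (card S)) \<and>
        0.475 * d * (real (card S) - 1) \<le> real (card (inner_edges E S))"
    let ?B = "\<lambda>R E. (4 * card R \<le> n \<and> real n \<le> X\<^sub>0 * real (card R)) \<and>
        real (card (boundary E R)) \<le> 0.525 * d * real (card R)"
    let ?D = "\<lambda>S E. X\<^sub>0 * real (card S) \<le> real n \<and>
        \<eta> / 4 * d * real (card S) \<le> real (card (inner_edges E S))"
    let ?L = "\<lambda>E. \<exists>u\<in>?V. \<exists>v\<in>?V. u \<noteq> v \<and> low n J u E \<and> low n J v E \<and>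
        ({u, v} \<in> E \<or> (\<exists>w\<in>?V - {u, v}. {u, w} \<in> E \<and> {v, w} \<in> E))"
    let ?y = "exp (- (ln (real n) / 4) * (real n / X\<^sub>0) / 320)"
    have M: "bprob ?F p ?M \<le> 2 * exp (- (ln (real n) / 4) * (real n - 1) / 5000)"
    proof -
      have "ln (real n) / 4 * (real n - 1) \<le> d * (real n - 1)"
        using d4 n by (intro mult_right_mono) auto
      then have "2 * exp (- d * (real n - 1) / 5000) \<le> 2 * exp (- (ln (real n) / 4) * (real n - 1) / 5000)"
      by simp
    with n show ?thesis by (intro order_trans[OF prob_edge_count[OF p d_def]]) auto
    qed
    have mid: "exp (- d * real s / 320) \<le> ?y" if "real n \<le> X\<^sub>0 * real s" for s
    proof -
      have "real n / X\<^sub>0 \<le> real s" using that X0_ge_1 by (simp add: field_simps)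
      then have "ln (real n) / 4 * (real n / X\<^sub>0) \<le> d * real s"
        using d4 e4 d0 X0_ge_1 by (intro mult_mono) auto
      then show ?thesis by (simp add: mult.commute)
    qed
    have I: "bprob ?F p (\<lambda>E. \<exists>S\<in>Pow ?V. ?I S E) \<le> 2 ^ card ?V * ?y"
    proof (rule prob_exists_set_uniform[OF p])
      fix S assume S: "S \<subseteq> ?V"
      show "bprob ?F p (?I S) \<le> ?y"
        using prob_inner_dense[OF p d_def S] mid[of "card S"]
        by (intro bprob_guard) (auto intro: order_trans)
    qed auto
    have B: "bprob ?F p (\<lambda>E. \<exists>S\<in>Pow ?V. ?B S E) \<le> 2 ^ card ?V * ?y"
    proof (rule prob_exists_set_uniform[OF p])
      fix S assume S: "S \<subseteq> ?V"
      show "bprob ?F p (?B S) \<le> ?y"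
        using prob_boundary_sparse[OF p d_def S] mid[of "card S"]
        by (intro bprob_guard) (auto intro: order_trans)
    qed auto
    have D: "bprob ?F p (\<lambda>E. \<exists>S\<in>Pow ?V - {{}}. ?D S E) \<le> (1 + 1 / real n ^ 2) ^ card ?V - 1"
    proof (rule prob_exists_set[OF p])
      fix S assume S: "S \<subseteq> ?V"
      \<comment> \<open>The value 9 of the product leaves 8.5 d, and d \<ge> ln n / 4 makes this at
        least 2 ln n.\<close>
      have "1/2 - \<eta> / 4 * ln X\<^sub>0 = - 8.5" using eta_bounds by (simp add: X\<^sub>0_def)
      then have "exp (d * real (card S) * (1/2 - \<eta> / 4 * ln X\<^sub>0)) = exp (- (8.5 * d) * real (card S))"
        by simp
      moreover have "2 * ln (real n) \<le> 8.5 * d" using d4 e4 by linarith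
      then have "exp (- (8.5 * d) * real (card S)) \<le> (1 / real n ^ 2) ^ card S"
        using n by (intro exp_neg_le_inverse_square) auto
      ultimately show "bprob ?F p (?D S) \<le> (1 / real n ^ 2) ^ card S"
        using prob_small_dense[OF p d_def S X0_ge_1, of "\<eta> / 4"]
        by (intro bprob_guard) (auto intro: order_trans)
    qed auto
    have L: "bprob ?F p ?L \<le> (4 * real n * (640 * ln (real n)) + 16 * real n * (640 * ln (real n))\<^sup>2)
         * (25600 * real n powr (- 0.825))\<^sup>2"
    proof -
      have "bprob ?F p ?L \<le> (4 * real n ^ 2 * p + 16 * real n ^ 3 * p\<^sup>2) * (?q J)\<^sup>2"
        using p p2 n by (rule prob_close_low_pair)
      also have "4 * real n ^ 2 * p + 16 * real n ^ 3 * p\<^sup>2 = 4 * real n * d + 16 * real n * d\<^sup>2"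
        by (simp add: d_def power2_eq_square power3_eq_cube)
      also have "(4 * real n * d + 16 * real n * d\<^sup>2) * (?q J)\<^sup>2 \<le>
          (4 * real n * (640 * ln (real n)) + 16 * real n * (640 * ln (real n))\<^sup>2)
           * (25600 * real n powr (- 0.825))\<^sup>2"
        using qJ dn d0 p e4
        by (intro mult_mono add_mono mult_left_mono power_mono bcdf_nonneg add_nonneg_nonneg) (auto simp: d_def)
      finally show ?thesis .
    qed
    let ?Bad = "\<lambda>E. ?N E \<or> ?M E \<or> (\<exists>S\<in>Pow ?V. ?I S E) \<or> (\<exists>S\<in>Pow ?V. ?B S E) \<or>
        (\<exists>S\<in>Pow ?V - {{}}. ?D S E) \<or> ?L E"
    have "bprob ?F p (\<lambda>E. \<not> packing_formula n E) \<le> bprob ?F p ?Bad"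
    proof (rule bprob_mono[OF p], rule ccontr)
      fix E assume E: "E \<subseteq> ?F" and fail: "\<not> packing_formula n E" and nb: "\<not> ?Bad E"
      then have N: "\<not> ?N E" and M: "\<not> ?M E" and I: "\<And>S. S \<subseteq> ?V \<Longrightarrow> \<not> ?I S E"
        and B: "\<And>S. S \<subseteq> ?V \<Longrightarrow> \<not> ?B S E" and D: "\<And>S. S \<subseteq> ?V \<Longrightarrow> S \<noteq> {} \<Longrightarrow> \<not> ?D S E"
        and L: "\<not> ?L E" by blast+
      let ?T = "min (min_degree n E) (card E div (n - 1))"
      have Tk: "?T \<le> k" using deg_low[OF E N] by simp
      have "packing_formula n E"
      proof (rule packing_eq_if_dense[OF _ E refl, where D = "0.475 * d"])
        fix S assume S: "S \<subseteq> ?V" "2 \<le> card S" "4 * card S \<le> 3 * n"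
        show "real (card (inner_edges E S)) \<le> 0.475 * d * (real (card S) - 1)"
        proof (cases "real n \<le> X\<^sub>0 * real (card S)")
          case True
          then show ?thesis using I[OF S(1)] S(2,3) by linarith
        next
          case False
          have "S \<noteq> {}" using S(2) by auto
          then have "real (card (inner_edges E S)) \<le> \<eta> / 4 * d * real (card S)"
            using D[OF S(1)] False by linarith
          \<comment> \<open>As s \<le> 2 (s - 1), a density of 0.2 per vertex stays below 0.475 per
            s - 1.\<close>
          also have "\<dots> \<le> 0.2 * d * real (card S)"
            using eta_bounds d0 by (intro mult_right_mono) auto
          also have "\<dots> \<le> 0.2 * d * (2 * (real (card S) - 1))"
            using S(2) d0 by (intro mult_left_mono) auto
          also have "\<dots> \<le> 0.475 * d * (real (card S) - 1)"
            using mult_nonneg_nonneg[of d "real (card S) - 1"] d0 S(2) by (simp add: algebra_simps)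
          finally show ?thesis .
        qed
      next
        fix R assume R: "R \<subseteq> ?V" "R \<noteq> {}" "4 * card R < n"
        have finR: "finite R" using R(1) by (rule finite_subset) simp
        show "?T * card R \<le> card (boundary E R)"
        proof (cases "real n \<le> X\<^sub>0 * real (card R)")
          case True
          have "real ?T * real (card R) \<le> 0.525 * d * real (card R)"
            using n M by (intro mult_right_mono real_packing_bound) auto
          also have "\<dots> \<le> real (card (boundary E R))" using B[OF R(1)] R(3) True by linarith
          finally have "real (?T * card R) \<le> real (card (boundary E R))" by simp
          then show ?thesis by (simp only: of_nat_le_iff)
        next
          case False
          \<comment> \<open>This set also contains every number outside [n], whose star is empty;
            hence the intersections with {1..n} in \<open>light_cut\<close>.\<close>
          let ?A = "{v. low n J v E}"
          show ?thesis
          proof (rule light_cut[OF E R(1), where L = ?A and h = "\<eta> * d" and c = "\<eta> / 4 * d"])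
            fix v assume v: "v \<in> R"
            then have "v \<in> ?V" using R(1) by blast
            then show "?T \<le> degree E v" using min_degree_le[of v n E] by linarith
          next
            fix v assume "v \<in> R - ?A"
            then have "J < degree E v" using E by (simp add: low_def degree_eq_card_star)
            then have "real k + real (nat \<lfloor>\<eta> * d\<rfloor>) + 1 \<le> real (degree E v)"
              unfolding J_def by linarith
            moreover have "\<eta> * d \<le> real (nat \<lfloor>\<eta> * d\<rfloor>) + 1"
              using eta_bounds d0 by (simp add: of_nat_nat)
            moreover have "real ?T \<le> real k" using Tk by (simp only: of_nat_le_iff)
            ultimately show "real ?T + \<eta> * d \<le> real (degree E v)" by linarith
          next
            fix u v assume "u \<in> ?A \<inter> ?V" "v \<in> ?A \<inter> ?V" "u \<noteq> v"
            then show "{u, v} \<notin> E" using L by blast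
          next
            fix u v w assume uv: "u \<in> ?A \<inter> ?V" "v \<in> ?A \<inter> ?V" "u \<noteq> v" "w \<notin> {u, v}" "{u, w} \<in> E"
            have "{u, w} \<subseteq> ?V" using uv(5) E all_edges_iff[of "{u, w}" n] by blast
            then have "w \<in> ?V - {u, v}" using uv(4) by blast
            then show "{v, w} \<notin> E" using L uv by blast
          next
            show "real (card (inner_edges E (R - ?A))) \<le> \<eta> / 4 * d * real (card (R - ?A))"
            proof (cases "R - ?A = {}")
              case True
              have "inner_edges E {} = {}"
                using E all_edges_iff[of "{}" n] by (auto simp: inner_edges_def)
              then show ?thesis unfolding True by simp
            next
              case ne: False
              have "X\<^sub>0 * real (card (R - ?A)) \<le> X\<^sub>0 * real (card R)"
                using X0_ge_1 finR by (intro mult_left_mono) (auto intro: card_mono)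
              then show ?thesis using D[OF _ ne] R(1) False by force
            qed
          next
            \<comment> \<open>The requirement 2 c + 2 \<le> h amounts to \<open>\<eta> * d\<close>
              \<ge> 4.\<close>
            have "\<eta> * (ln (real n) / 4) \<le> \<eta> * d" using d4 eta_bounds by (intro mult_left_mono) auto
            then show "2 * (\<eta> / 4 * d) + 2 \<le> \<eta> * d" using large(2) by (simp add: field_simps)
          qed
        qed
      qed (use n M in auto)
      with fail show False by contradiction
    qed
    also have "\<dots> \<le> bprob ?F p ?N + (bprob ?F p ?M + (bprob ?F p (\<lambda>E. \<exists>S\<in>Pow ?V. ?I S E) +
        (bprob ?F p (\<lambda>E. \<exists>S\<in>Pow ?V. ?B S E) + (bprob ?F p (\<lambda>E. \<exists>S\<in>Pow ?V - {{}}. ?D S E) +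
        bprob ?F p ?L))))"
      by (intro order_trans[OF bprob_disj[OF p]] add_mono order_refl)
    also have "\<dots> \<le> err_sparse n" using N M I B D L by (simp add: err_sparse_def)
    finally show ?thesis .
  qed
qed

theorem theorem2p1:
  fixes p :: "nat \<Rightarrow> real"
  assumes "\<And>n. 0 \<le> p n \<and> p n \<le> 1"
  shows "(\<lambda>n. prob_Gnp n (p n)
            (\<lambda>E. tree_packing n E = min (min_degree n E) (card E div (n - 1))))
         \<longlonglongrightarrow> 1"
proof -
  let ?fail = "\<lambda>n. bprob (all_edges n) (p n) (\<lambda>E. \<not> packing_formula n E)"
  have "eventually (\<lambda>n. 640 * ln (real n) / real n \<le> 1/2) sequentially" by real_asymp
  moreover have "eventually (\<lambda>n. 4 \<le> \<eta> * (ln (real n) / 4)) sequentially"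
    using eta_bounds(1) by real_asymp
  moreover have "eventually (\<lambda>n. n \<ge> (3 :: nat)) sequentially" by (rule eventually_ge_at_top)
  \<comment> \<open>The maximum is needed because p n may lie in different ranges for different
    n.\<close>
  ultimately have bound: "eventually (\<lambda>n. ?fail n \<le> max (err_dense n) (err_sparse n)) sequentially"
  proof eventually_elim
    case (elim n)
    have p: "0 \<le> p n" "p n \<le> 1" using assms by auto
    show ?case
      using prob_fail_dense[OF p elim(3)] prob_fail_sparse[OF p elim(3) _ elim(1,2)]
      by (cases "640 * ln (real n) \<le> real n * p n") auto
  qed
  have "(\<lambda>n. max (err_dense n) (err_sparse n)) \<longlonglongrightarrow> max 0 0"
    by (intro tendsto_max err_dense_tendsto err_sparse_tendsto)
  then have "?fail \<longlonglongrightarrow> 0"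
    using bound assms
    by (intro tendsto_sandwich[of "\<lambda>_. 0" ?fail sequentially "\<lambda>n. max (err_dense n) (err_sparse n)"])
      (auto simp: bprob_nonneg)
  then have "(\<lambda>n. 1 - ?fail n) \<longlonglongrightarrow> 1 - 0" by (intro tendsto_intros)
  then show ?thesis by (simp add: prob_Gnp_eq_bprob bprob_compl)
qed

end
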